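(* The $2$-functor $\tilde D:\mathsf{OPCA}_D\to\mathsf{ArrAlg}$, given by $\mathbb A\mapsto D\mathbb A$ and $f\mapsto\tilde f$ with $\tilde f(\alpha)=\bigcup_{a\in\alpha}f(a)$, restricts to a $2$-fully faithful $2$-functor $\mathsf{OPCA}_D\hookrightarrow\mathsf{ArrAlg}_{\mathsf{reg}}$. Explicitly, for all PCAs $\mathbb A$ and $\mathbb B$, $\tilde D$ realizes an equivalence of preorder categories $$\mathsf{OPCA}_D(\mathbb A,\mathbb B)\simeq\mathsf{ArrAlg}_{\mathsf{reg}}(D\mathbb A,D\mathbb B).$$
   Context: An arrow algebra $\mathcal A=(A,\preccurlyeq,\to,S)$ consists of a poset $(A,\preccurlyeq)$ with all meets $\bigwedge$; a binary operation $\to$ on $A$ (bracketed to the right), antitone in the first and monotone in the second argument; and a subset $S\subseteq A$ (the separator) which is upward closed, closed under modus ponens ($a\to b\in S$ and $a\in S$ imply $b\in S$), and contains the combinators $\mathbf k=\bigwedge_{a,b}a\to b\to a$, $\mathbf s=\bigwedge_{a,b,c}(a\to b\to c)\to(a\to b)\to a\to c$, and $\mathbf a=\bigwedge_{a,(b_i)_{i\in I},(c_i)_{i\in I}}\big(\bigwedge_{i\in I}a\to b_i\to c_i\big)\to a\to\bigwedge_{i\in I}(b_i\to c_i)$. The arrow tripos $P_{\mathcal A}$ has $P_{\mathcal A}(I)=(A^I,\vdash_I)$ with $\phi\vdash_I\psi$ iff $\bigwedge_{i\in I}\phi(i)\to\psi(i)\in S$, and reindexing $g^*$ by precomposition with $g$;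 for a function $g:X\to Y$, $\exists_g:P_{\mathcal A}(X)\to P_{\mathcal A}(Y)$ denotes the left adjoint of $g^*$. $\dashv\vdash_I$ denotes isomorphism for $\vdash_I$. An implicative morphism $f:\mathcal A\to\mathcal B$ is a function $f:A\to B$ such that: (i) $f(a)\in S_B$ for every $a\in S_A$; (ii) there is $r\in S_B$ with $r\preccurlyeq f(a\to a')\to f(a)\to f(a')$ for all $a,a'\in A$; (iii) for every $X\subseteq A\times A$, if $\bigwedge_{(a,a')\in X}a\to a'\in S_A$ then $\bigwedge_{(a,a')\in X}f(a)\to f(a')\in S_B$. Write $f\vdash f'$ if $\bigwedge_{a\in A}f(a)\to f'(a)\in S_B$. $\mathsf{ArrAlg}$ is the resulting preorder-enriched category. An implicative morphism $f$ is regular if $f\circ\exists_g(\alpha)\dashv\vdash_Y\exists_g(f\circ\alpha)$ for every function $g:X\to Y$ and $\alpha\in P_{\mathcal A}(X)$; $\mathsf{ArrAlg}_{\mathsf{reg}}$ is the wide subcategory of $\mathsf{ArrAlg}$ on regular implicative morphisms. PCA means filtered ordered partial combinatory algebra $\mathbb P=(P,\leq,\cdot,P^\#)$: a poset $(P,\le)$ with a partial binary application such that if $a\le a'$, $b\le b'$ and $a'b'$ is defined then $ab$ is defined and $ab\le a'b'$; a filter $P^\#\subseteq P$, i.e. an upward closed subset closed under defined application; and elements $\mathbf k,\mathbf s\in P^\#$ such that $\mathbf kab$ is defined and $\le a$; $\mathbf sab$ is defined; and if $ac(bc)$ is defined then $\mathbf sabc$ is defined and $\le ac(bc)$. Write $e\downarrow$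 for "$e$ is defined". A morphism of PCAs $\mathbb A\to\mathbb B$ is a function $f:A\to B$ with: $f(a)\in B^\#$ for $a\in A^\#$; there is $t\in B^\#$ such that if $aa'\downarrow$ then $tf(a)f(a')\downarrow$ and $tf(a)f(a')\le f(aa')$; there is $u\in B^\#$ such that if $a\le a'$ then $uf(a)\downarrow$ and $uf(a)\le f(a')$. Put $f\le f'$ if there is $s\in B^\#$ with $sf(a)\downarrow$ and $sf(a)\le f'(a)$ for all $a\in A$. This gives the preorder-enriched category $\mathsf{OPCA}$. For a PCA $\mathbb P$, $DP$ is the set of downward closed subsets of $P$ ordered by inclusion, with application $\alpha\cdot\beta=\{z: z\le xy \text{ for some } x\in\alpha,y\in\beta\}$, defined iff $xy\downarrow$ for all $x\in\alpha,y\in\beta$, and filter $(DP)^\#=\{\alpha\in DP:\alpha\cap P^\#\ne\emptyset\}$; this is a PCA $D\mathbb P$. It is also regarded as an arrow algebra $D\mathbb P=(DP,\subseteq,\to,(DP)^\#)$ with $\alpha\to\beta=\{a\in P: ax\downarrow\text{ and }ax\in\beta\text{ for all }x\in\alpha\}$. $\mathsf{OPCA}_D$ is the Kleisli (preorder-enriched) bicategory of the pseudomonad $D$ on $\mathsf{OPCA}$: objects are PCAs; morphisms $\mathbb A\to\mathbb B$, called partial applicative morphisms, are morphisms of PCAs $f:\mathbb A\to D\mathbb B$, ordered as in $\mathsf{OPCA}(\mathbb A,D\mathbb B)$; the composite of $f:\mathbb A\to\mathbb B$ and $g:\mathbb B\to\mathbb C$ is $a\mapsto\bigcup_{b\in f(a)}g(b)$;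 the identity is $a\mapsto\{x:x\le a\}$. A $2$-functor is $2$-fully faithful if it induces equivalences of preorders on hom-preorders. *)

theory Defs
  imports "HOL-Algebra.Lattice"
begin

section \<open>Arrow algebras and implicative morphisms\<close>

text \<open>
  Posets are HOL-Algebra's \<^typ>\<open>'a gorder\<close>, with an explicit carrier; the locale
  \<^locale>\<open>partial_order\<close> forces the field \<^const>\<open>eq\<close> to be equality. Meets are
  HOL-Algebra's \<^const>\<open>inf\<close>, i.e. greatest lower bounds within the carrier.
\<close>

record 'a arrow_structure = "'a gorder" +
  arr :: "'a \<Rightarrow> 'a \<Rightarrow> 'a" (infixr \<open>\<leadsto>\<index>\<close> 75)
  separator :: "'a set"

definition comb_k :: "('a, 'm) arrow_structure_scheme \<Rightarrow> 'a" where
  "comb_k A = \<Sqinter>\<^bsub>A\<^esub> {a \<leadsto>\<^bsub>A\<^esub> b \<leadsto>\<^bsub>A\<^esub> a | a b. a \<in> carrier A \<and> b \<in> carrier A}"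

definition comb_s :: "('a, 'm) arrow_structure_scheme \<Rightarrow> 'a" where
  "comb_s A =
    \<Sqinter>\<^bsub>A\<^esub> {(a \<leadsto>\<^bsub>A\<^esub> b \<leadsto>\<^bsub>A\<^esub> c) \<leadsto>\<^bsub>A\<^esub> (a \<leadsto>\<^bsub>A\<^esub> b) \<leadsto>\<^bsub>A\<^esub> a \<leadsto>\<^bsub>A\<^esub> c | a b c.
         a \<in> carrier A \<and> b \<in> carrier A \<and> c \<in> carrier A}"

text \<open>
  The combinator \<open>a\<close> is a meet over all pairs of families \<open>(b\<^sub>i)\<close>, \<open>(c\<^sub>i)\<close> with a common index
  set. Only the set \<open>Z\<close> of the pairs \<open>(b\<^sub>i, c\<^sub>i)\<close> matters, and every subset of
  \<open>A \<times> A\<close> (also the empty one) arises in this way.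
\<close>

definition comb_a :: "('a, 'm) arrow_structure_scheme \<Rightarrow> 'a" where
  "comb_a A =
    \<Sqinter>\<^bsub>A\<^esub> {(\<Sqinter>\<^bsub>A\<^esub> {a \<leadsto>\<^bsub>A\<^esub> b \<leadsto>\<^bsub>A\<^esub> c | b c. (b, c) \<in> Z})
           \<leadsto>\<^bsub>A\<^esub> a \<leadsto>\<^bsub>A\<^esub> (\<Sqinter>\<^bsub>A\<^esub> {b \<leadsto>\<^bsub>A\<^esub> c | b c. (b, c) \<in> Z}) | a Z.
         a \<in> carrier A \<and> Z \<subseteq> carrier A \<times> carrier A}"

locale arrow_algebra = partial_order A for A :: "('a, 'm) arrow_structure_scheme" (structure) +
  assumes meets_exist: "X \<subseteq> carrier A \<Longrightarrow> \<exists>m. is_glb A m X"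
    and arr_closed: "\<lbrakk>a \<in> carrier A; b \<in> carrier A\<rbrakk> \<Longrightarrow> a \<leadsto> b \<in> carrier A"
    and arr_mono: "\<lbrakk>a \<in> carrier A; a' \<in> carrier A; b \<in> carrier A; b' \<in> carrier A;
        a' \<sqsubseteq> a; b \<sqsubseteq> b'\<rbrakk> \<Longrightarrow> a \<leadsto> b \<sqsubseteq> a' \<leadsto> b'"
    and separator_subset: "separator A \<subseteq> carrier A"
    and separator_upward: "\<lbrakk>a \<in> separator A; b \<in> carrier A; a \<sqsubseteq> b\<rbrakk> \<Longrightarrow> b \<in> separator A"
    and modus_ponens: "\<lbrakk>a \<in> carrier A; b \<in> carrier A; a \<leadsto> b \<in> separator A; a \<in> separator A\<rbrakk>
        \<Longrightarrow> b \<in> separator A"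
    and k_in_separator: "comb_k A \<in> separator A"
    and s_in_separator: "comb_s A \<in> separator A"
    and a_in_separator: "comb_a A \<in> separator A"

text \<open>
  The arrow tripos: the elements of its fibre over a set \<open>I\<close> are the functions in
  \<open>I \<rightarrow> carrier A\<close>; their values outside \<open>I\<close> are irrelevant to the entailment.
\<close>

definition entails ::
  "('a, 'm) arrow_structure_scheme \<Rightarrow> 'i set \<Rightarrow> ('i \<Rightarrow> 'a) \<Rightarrow> ('i \<Rightarrow> 'a) \<Rightarrow> bool" where
  "entails A I \<phi> \<psi> \<longleftrightarrow> \<Sqinter>\<^bsub>A\<^esub> {\<phi> i \<leadsto>\<^bsub>A\<^esub> \<psi> i | i. i \<in> I} \<in> separator A"

definition iso_entails ::
  "('a, 'm) arrow_structure_scheme \<Rightarrow> 'i set \<Rightarrow> ('i \<Rightarrow> 'a) \<Rightarrow> ('i \<Rightarrow> 'a) \<Rightarrow> bool" where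
  "iso_entails A I \<phi> \<psi> \<longleftrightarrow> entails A I \<phi> \<psi> \<and> entails A I \<psi> \<phi>"

text \<open>\<open>E\<close> is left adjoint to reindexing along \<open>g : X \<rightarrow> Y\<close>; such an \<open>E\<close> is unique up to isomorphism.\<close>

definition is_exists_along ::
  "('a, 'm) arrow_structure_scheme \<Rightarrow> 'i set \<Rightarrow> 'j set \<Rightarrow> ('i \<Rightarrow> 'j)
    \<Rightarrow> (('i \<Rightarrow> 'a) \<Rightarrow> ('j \<Rightarrow> 'a)) \<Rightarrow> bool" where
  "is_exists_along A X Y g E \<longleftrightarrow>
     E \<in> (X \<rightarrow> carrier A) \<rightarrow> (Y \<rightarrow> carrier A) \<and>
     (\<forall>\<alpha> \<in> X \<rightarrow> carrier A. \<forall>\<psi> \<in> Y \<rightarrow> carrier A.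
        entails A Y (E \<alpha>) \<psi> \<longleftrightarrow> entails A X \<alpha> (\<psi> \<circ> g))"

definition implicative_morphism ::
  "('a, 'm) arrow_structure_scheme \<Rightarrow> ('b, 'n) arrow_structure_scheme \<Rightarrow> ('a \<Rightarrow> 'b) \<Rightarrow> bool" where
  "implicative_morphism A B f \<longleftrightarrow>
     f \<in> carrier A \<rightarrow> carrier B \<and>
     (\<forall>a \<in> separator A. f a \<in> separator B) \<and>
     (\<exists>r \<in> separator B. \<forall>a \<in> carrier A. \<forall>a' \<in> carrier A.
        r \<sqsubseteq>\<^bsub>B\<^esub> f (a \<leadsto>\<^bsub>A\<^esub> a') \<leadsto>\<^bsub>B\<^esub> f a \<leadsto>\<^bsub>B\<^esub> f a') \<and>
     (\<forall>X \<subseteq> carrier A \<times> carrier A.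
        \<Sqinter>\<^bsub>A\<^esub> {a \<leadsto>\<^bsub>A\<^esub> a' | a a'. (a, a') \<in> X} \<in> separator A \<longrightarrow>
        \<Sqinter>\<^bsub>B\<^esub> {f a \<leadsto>\<^bsub>B\<^esub> f a' | a a'. (a, a') \<in> X} \<in> separator B)"

text \<open>
  Regularity quantifies over functions between arbitrary sets, which in HOL must be sets over
  some types. \<open>regular_over\<close> is the condition for sets over two given types. For \<open>regular\<close> the
  types are chosen large enough for the sets \<open>Y = Pow (carrier A)\<close> and
  \<open>X = {(R, a). a \<in> R \<and> R \<in> Y}\<close>. These suffice for the condition over all types: the left adjoint
  along \<open>g\<close> at \<open>\<alpha>\<close> is, up to isomorphism, obtained by reindexing from the one along
  \<open>fst : X \<rightarrow> Y\<close> at \<open>snd\<close>, via \<open>y \<mapsto> \<alpha> ` {x. g x = y}\<close>.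
\<close>

definition regular_over ::
  "'i itself \<Rightarrow> 'j itself \<Rightarrow> ('a, 'm) arrow_structure_scheme \<Rightarrow> ('b, 'n) arrow_structure_scheme
    \<Rightarrow> ('a \<Rightarrow> 'b) \<Rightarrow> bool" where
  "regular_over _ _ A B f \<longleftrightarrow>
     (\<forall>(X :: 'i set) (Y :: 'j set). \<forall>g \<in> X \<rightarrow> Y. \<forall>EA EB.
        is_exists_along A X Y g EA \<longrightarrow> is_exists_along B X Y g EB \<longrightarrow>
        (\<forall>\<alpha> \<in> X \<rightarrow> carrier A. iso_entails B Y (f \<circ> EA \<alpha>) (EB (f \<circ> \<alpha>))))"

definition regular ::
  "('a, 'm) arrow_structure_scheme \<Rightarrow> ('b, 'n) arrow_structure_scheme \<Rightarrow> ('a \<Rightarrow> 'b) \<Rightarrow> bool" where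
  "regular A B f \<longleftrightarrow> regular_over TYPE('a set \<times> 'a) TYPE('a set) A B f"

definition ArrAlg ::
  "('a, 'm) arrow_structure_scheme \<Rightarrow> ('b, 'n) arrow_structure_scheme \<Rightarrow> ('a \<Rightarrow> 'b) set" where
  "ArrAlg A B = {f. implicative_morphism A B f}"

definition ArrAlg_reg ::
  "('a, 'm) arrow_structure_scheme \<Rightarrow> ('b, 'n) arrow_structure_scheme \<Rightarrow> ('a \<Rightarrow> 'b) set" where
  "ArrAlg_reg A B = {f \<in> ArrAlg A B. regular A B f}"

definition ArrAlg_le ::
  "('a, 'm) arrow_structure_scheme \<Rightarrow> ('b, 'n) arrow_structure_scheme
    \<Rightarrow> ('a \<Rightarrow> 'b) \<Rightarrow> ('a \<Rightarrow> 'b) \<Rightarrow> bool" where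
  "ArrAlg_le A B f f' \<longleftrightarrow> entails B (carrier A) f f'"


section \<open>Filtered ordered partial combinatory algebras\<close>

text \<open>Application is partial: \<^const>\<open>None\<close> means undefined.\<close>

record 'a pca_structure = "'a gorder" +
  app :: "'a \<Rightarrow> 'a \<Rightarrow> 'a option" (infixl \<open>\<bullet>\<index>\<close> 70)
  filt :: "'a set"

text \<open>Application of possibly undefined terms, strict in both arguments.\<close>

definition papp ::
  "('a, 'm) pca_structure_scheme \<Rightarrow> 'a option \<Rightarrow> 'a option \<Rightarrow> 'a option" (infixl \<open>\<odot>\<index>\<close> 70) where
  "u \<odot>\<^bsub>P\<^esub> v = Option.bind u (\<lambda>x. Option.bind v (\<lambda>y. x \<bullet>\<^bsub>P\<^esub> y))"

text \<open>\<open>defined_le P u c\<close>: the term \<open>u\<close> is defined and its value is below \<open>c\<close>.\<close>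

definition defined_le :: "('a, 'm) pca_structure_scheme \<Rightarrow> 'a option \<Rightarrow> 'a \<Rightarrow> bool" where
  "defined_le P u c \<longleftrightarrow> (\<exists>v. u = Some v \<and> v \<sqsubseteq>\<^bsub>P\<^esub> c)"

locale pca = partial_order P for P :: "('a, 'm) pca_structure_scheme" (structure) +
  assumes app_closed: "\<lbrakk>a \<in> carrier P; b \<in> carrier P; a \<bullet> b = Some c\<rbrakk> \<Longrightarrow> c \<in> carrier P"
    and app_mono: "\<lbrakk>a \<in> carrier P; a' \<in> carrier P; b \<in> carrier P; b' \<in> carrier P;
        a \<sqsubseteq> a'; b \<sqsubseteq> b'; a' \<bullet> b' = Some c'\<rbrakk> \<Longrightarrow> defined_le P (a \<bullet> b) c'"
    and filt_subset: "filt P \<subseteq> carrier P"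
    and filt_upward: "\<lbrakk>a \<in> filt P; b \<in> carrier P; a \<sqsubseteq> b\<rbrakk> \<Longrightarrow> b \<in> filt P"
    and filt_app: "\<lbrakk>a \<in> filt P; b \<in> filt P; a \<bullet> b = Some c\<rbrakk> \<Longrightarrow> c \<in> filt P"
    and combinators: "\<exists>k \<in> filt P. \<exists>s \<in> filt P.
        (\<forall>a \<in> carrier P. \<forall>b \<in> carrier P. defined_le P (Some k \<odot> Some a \<odot> Some b) a) \<and>
        (\<forall>a \<in> carrier P. \<forall>b \<in> carrier P. Some s \<odot> Some a \<odot> Some b \<noteq> None) \<and>
        (\<forall>a \<in> carrier P. \<forall>b \<in> carrier P. \<forall>c \<in> carrier P. \<forall>v.
           Some a \<odot> Some c \<odot> (Some b \<odot> Some c) = Some v \<longrightarrow>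
           defined_le P (Some s \<odot> Some a \<odot> Some b \<odot> Some c) v)"

definition OPCA ::
  "('a, 'm) pca_structure_scheme \<Rightarrow> ('b, 'n) pca_structure_scheme \<Rightarrow> ('a \<Rightarrow> 'b) set" where
  "OPCA A B = {f \<in> carrier A \<rightarrow> carrier B.
     (\<forall>a \<in> filt A. f a \<in> filt B) \<and>
     (\<exists>t \<in> filt B. \<forall>a \<in> carrier A. \<forall>a' \<in> carrier A. \<forall>c. a \<bullet>\<^bsub>A\<^esub> a' = Some c \<longrightarrow>
        defined_le B (Some t \<odot>\<^bsub>B\<^esub> Some (f a) \<odot>\<^bsub>B\<^esub> Some (f a')) (f c)) \<and>
     (\<exists>u \<in> filt B. \<forall>a \<in> carrier A. \<forall>a' \<in> carrier A. a \<sqsubseteq>\<^bsub>A\<^esub> a' \<longrightarrow>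
        defined_le B (u \<bullet>\<^bsub>B\<^esub> f a) (f a'))}"

definition OPCA_le ::
  "('a, 'm) pca_structure_scheme \<Rightarrow> ('b, 'n) pca_structure_scheme
    \<Rightarrow> ('a \<Rightarrow> 'b) \<Rightarrow> ('a \<Rightarrow> 'b) \<Rightarrow> bool" where
  "OPCA_le A B f f' \<longleftrightarrow> (\<exists>s \<in> filt B. \<forall>a \<in> carrier A. defined_le B (s \<bullet>\<^bsub>B\<^esub> f a) (f' a))"


section \<open>Downsets and the Kleisli bicategory\<close>

definition downsets :: "('a, 'm) gorder_scheme \<Rightarrow> 'a set set" where
  "downsets P = {\<alpha>. \<alpha> \<subseteq> carrier P \<and> (\<forall>x \<in> \<alpha>. \<forall>z \<in> carrier P. z \<sqsubseteq>\<^bsub>P\<^esub> x \<longrightarrow> z \<in> \<alpha>)}"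

definition D_filter :: "('a, 'm) pca_structure_scheme \<Rightarrow> 'a set set" where
  "D_filter P = {\<alpha> \<in> downsets P. \<alpha> \<inter> filt P \<noteq> {}}"

definition D_pca :: "('a, 'm) pca_structure_scheme \<Rightarrow> 'a set pca_structure" where
  "D_pca P = \<lparr> carrier = downsets P, eq = (=), le = (\<subseteq>),
     app = (\<lambda>\<alpha> \<beta>. if \<forall>x \<in> \<alpha>. \<forall>y \<in> \<beta>. x \<bullet>\<^bsub>P\<^esub> y \<noteq> None
       then Some {z \<in> carrier P. \<exists>x \<in> \<alpha>. \<exists>y \<in> \<beta>. z \<sqsubseteq>\<^bsub>P\<^esub> the (x \<bullet>\<^bsub>P\<^esub> y)}
       else None),
     filt = D_filter P \<rparr>"

definition D_alg :: "('a, 'm) pca_structure_scheme \<Rightarrow> 'a set arrow_structure" where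
  "D_alg P = \<lparr> carrier = downsets P, eq = (=), le = (\<subseteq>),
     arr = (\<lambda>\<alpha> \<beta>. {a \<in> carrier P. \<forall>x \<in> \<alpha>. \<exists>v \<in> \<beta>. a \<bullet>\<^bsub>P\<^esub> x = Some v}),
     separator = D_filter P \<rparr>"

definition OPCA_D ::
  "('a, 'm) pca_structure_scheme \<Rightarrow> ('b, 'n) pca_structure_scheme \<Rightarrow> ('a \<Rightarrow> 'b set) set" where
  "OPCA_D A B = OPCA A (D_pca B)"

definition OPCA_D_le ::
  "('a, 'm) pca_structure_scheme \<Rightarrow> ('b, 'n) pca_structure_scheme
    \<Rightarrow> ('a \<Rightarrow> 'b set) \<Rightarrow> ('a \<Rightarrow> 'b set) \<Rightarrow> bool" where
  "OPCA_D_le A B = OPCA_le A (D_pca B)"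

definition kleisli_id :: "('a, 'm) pca_structure_scheme \<Rightarrow> 'a \<Rightarrow> 'a set" where
  "kleisli_id A a = {x \<in> carrier A. x \<sqsubseteq>\<^bsub>A\<^esub> a}"

definition kleisli_comp :: "('b \<Rightarrow> 'c set) \<Rightarrow> ('a \<Rightarrow> 'b set) \<Rightarrow> 'a \<Rightarrow> 'c set" where
  "kleisli_comp g f a = (\<Union>b \<in> f a. g b)"

definition D_tilde :: "('a \<Rightarrow> 'b set) \<Rightarrow> 'a set \<Rightarrow> 'b set" where
  "D_tilde f \<alpha> = (\<Union>a \<in> \<alpha>. f a)"


section \<open>Equivalences of preorders\<close>

definition preorder_equivalence ::
  "'p set \<Rightarrow> ('p \<Rightarrow> 'p \<Rightarrow> bool) \<Rightarrow> 'q set \<Rightarrow> ('q \<Rightarrow> 'q \<Rightarrow> bool) \<Rightarrow> ('p \<Rightarrow> 'q) \<Rightarrow> bool" where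
  "preorder_equivalence P leP Q leQ F \<longleftrightarrow>
     F \<in> P \<rightarrow> Q \<and> monotone_on P leP leQ F \<and>
     (\<exists>G \<in> Q \<rightarrow> P. monotone_on Q leQ leP G \<and>
        (\<forall>p \<in> P. leP (G (F p)) p \<and> leP p (G (F p))) \<and>
        (\<forall>q \<in> Q. leQ (F (G q)) q \<and> leQ q (F (G q))))"

end

theory Submission
  imports Defs
begin

text \<open>
  The theorem becomes transparent once every condition is phrased through realizers. In
  \<open>D_alg P\<close> the meet of a family of downsets lies in the separator iff a single element of
  \<open>filt P\<close> lies in all of them. Hence \<open>\<phi> \<turnstile>\<^sub>I \<psi>\<close> says that one \<open>e \<in> filt P\<close> maps \<open>\<phi> i\<close> into
  \<open>\<psi> i\<close> for every \<open>i\<close> (\<open>entails_D_alg_iff\<close>). Application in \<open>D_pca P\<close> is left adjoint to the arrow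
  of \<open>D_alg P\<close>, so partial applicative morphisms and their order are also described by single
  elements of the filter lying in families of arrows (\<open>OPCA_D_iff\<close>, \<open>OPCA_D_le_iff\<close>), and so are
  implicative morphisms (\<open>ArrAlg_D_alg_iff\<close>). Combinatory completeness supplies the elements.

  An element realizes \<open>\<Union>\<S> \<leadsto> \<beta>\<close> iff it realizes \<open>\<alpha> \<leadsto> \<beta>\<close> for every \<open>\<alpha> \<in> \<S>\<close>, so unions over fibres
  are existential quantification in the tripos of \<open>D_alg P\<close>. The map \<open>D_tilde f\<close> preserves unions
  on the nose and is therefore regular. Conversely, regularity of \<open>g\<close> along the projection from the
  membership relation to the set of families of downsets says that \<open>g (\<Union>\<S>)\<close> and \<open>\<Union> (g ` \<S>)\<close> agree
  up to realizers that are uniform in \<open>\<S>\<close> (\<open>regular_Union_realizers\<close>). Every downset is the union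
  of the principal downsets of its elements, so \<open>g\<close> is recovered, up to isomorphism, from its
  values on principal downsets: \<open>a \<mapsto> g (principal a)\<close> is the inverse of \<open>D_tilde\<close>.

  This inverse is a partial applicative morphism because \<open>a a' = c\<close> gives the inclusion
  \<open>principal a \<subseteq> (principal a' \<leadsto> principal c)\<close>. All these inclusions are realized by the same
  element, the identity, so condition (iii) on implicative morphisms turns them into one element
  of the filter of the target, which is then composed with the realizer of condition (ii). The
  remaining isomorphism \<open>f a \<cong> \<Union>b \<sqsubseteq> a. f b\<close> is exactly the requirement that \<open>f\<close> is uniformly
  monotone.
\<close>

section \<open>Downsets as truth values\<close>

abbreviation (input) principal :: "('a, 'm) pca_structure_scheme \<Rightarrow> 'a \<Rightarrow> 'a set" where
  "principal \<equiv> kleisli_id"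

lemma papp_Some [simp]: "Some x \<odot>\<^bsub>P\<^esub> Some y = x \<bullet>\<^bsub>P\<^esub> y"
  by (simp add: papp_def)

text \<open>
  The phrase ``the term \<open>u\<close> is defined and its value lies in \<open>\<gamma>\<close>'' is rendered throughout as
  \<open>u \<in> Some ` \<gamma>\<close>. For \<open>\<gamma> = principal P c\<close> it is the relation \<open>defined_le P u c\<close>, with the value in the
  carrier.
\<close>

lemma papp_in_image_iff:
  "u \<odot>\<^bsub>P\<^esub> v \<in> Some ` \<gamma> \<longleftrightarrow> (\<exists>x y. u = Some x \<and> v = Some y \<and> x \<bullet>\<^bsub>P\<^esub> y \<in> Some ` \<gamma>)"
  by (cases u; cases v) (simp_all add: papp_def image_iff)

lemma D_alg_simps [simp]:
  "carrier (D_alg P) = downsets P" "le (D_alg P) = (\<subseteq>)" "eq (D_alg P) = (=)"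
  "separator (D_alg P) = D_filter P"
  by (simp_all add: D_alg_def)

lemma D_pca_simps [simp]:
  "carrier (D_pca P) = downsets P" "le (D_pca P) = (\<subseteq>)" "filt (D_pca P) = D_filter P"
  by (simp_all add: D_pca_def)

lemma mem_arr_D_alg:
  "a \<in> \<alpha> \<leadsto>\<^bsub>D_alg P\<^esub> \<beta> \<longleftrightarrow> a \<in> carrier P \<and> (\<forall>x \<in> \<alpha>. a \<bullet>\<^bsub>P\<^esub> x \<in> Some ` \<beta>)"
  by (auto simp: D_alg_def)

lemma arr_D_algE:
  assumes "a \<in> \<alpha> \<leadsto>\<^bsub>D_alg P\<^esub> \<beta>" "x \<in> \<alpha>"
  obtains v where "a \<bullet>\<^bsub>P\<^esub> x = Some v" "v \<in> \<beta>"
  using assms by (auto simp: mem_arr_D_alg)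

lemma arr_D_alg_carrier: "a \<in> \<alpha> \<leadsto>\<^bsub>D_alg P\<^esub> \<beta> \<Longrightarrow> a \<in> carrier P"
  by (simp add: mem_arr_D_alg)

lemma arr_D_alg_mono: "\<lbrakk>\<alpha>' \<subseteq> \<alpha>; \<beta> \<subseteq> \<beta>'\<rbrakk> \<Longrightarrow> \<alpha> \<leadsto>\<^bsub>D_alg P\<^esub> \<beta> \<subseteq> \<alpha>' \<leadsto>\<^bsub>D_alg P\<^esub> \<beta>'"
  by (fastforce simp: mem_arr_D_alg)

lemma downsets_subset: "\<alpha> \<in> downsets P \<Longrightarrow> \<alpha> \<subseteq> carrier P"
  by (simp add: downsets_def)

lemma downsetsD: "\<lbrakk>\<alpha> \<in> downsets P; x \<in> \<alpha>; z \<in> carrier P; z \<sqsubseteq>\<^bsub>P\<^esub> x\<rbrakk> \<Longrightarrow> z \<in> \<alpha>"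
  by (auto simp: downsets_def)

lemma Union_downsets: "X \<subseteq> downsets P \<Longrightarrow> \<Union>X \<in> downsets P"
  by (fastforce simp: downsets_def)

lemma carrier_Inter_downsets: "X \<subseteq> downsets P \<Longrightarrow> carrier P \<inter> \<Inter>X \<in> downsets P"
  by (fastforce simp: downsets_def)

lemma partial_order_D_alg: "partial_order (D_alg P)"
  by unfold_locales auto

lemma is_glb_D_alg:
  assumes "X \<subseteq> downsets P"
  shows "is_glb (D_alg P) (carrier P \<inter> \<Inter>X) X"
  using assms carrier_Inter_downsets[OF assms]
  by (intro greatest_LowerI) (auto simp: Lower_def dest: downsets_subset)

lemma Inf_D_alg:
  assumes "X \<subseteq> downsets P"
  shows "\<Sqinter>\<^bsub>D_alg P\<^esub> X = carrier P \<inter> \<Inter>X"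
proof -
  interpret partial_order "D_alg P" by (rule partial_order_D_alg)
  show ?thesis
    unfolding inf_def
    by (rule some_equality, rule is_glb_D_alg[OF assms])
      (erule greatest_unique, rule is_glb_D_alg[OF assms])
qed

context pca begin

lemma principal_downset: "a \<in> carrier P \<Longrightarrow> principal P a \<in> downsets P"
  by (auto simp: kleisli_id_def downsets_def intro: le_trans)

lemma principal_self: "a \<in> carrier P \<Longrightarrow> a \<in> principal P a"
  by (auto simp: kleisli_id_def)

lemma principal_subset_iff:
  "\<lbrakk>\<alpha> \<in> downsets P; a \<in> carrier P\<rbrakk> \<Longrightarrow> principal P a \<subseteq> \<alpha> \<longleftrightarrow> a \<in> \<alpha>"
  by (auto simp: kleisli_id_def downsets_def)

lemma principal_D_filter: "a \<in> filt P \<Longrightarrow> principal P a \<in> D_filter P"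
  using filt_subset principal_downset principal_self by (auto simp: D_filter_def)

lemma Union_principal:
  assumes "\<alpha> \<in> downsets P"
  shows "\<Union> (principal P ` \<alpha>) = \<alpha>"
proof (rule antisym)
  have sub: "\<alpha> \<subseteq> carrier P" by (rule downsets_subset[OF assms])
  show "\<Union> (principal P ` \<alpha>) \<subseteq> \<alpha>"
  proof (rule UN_least)
    fix a assume "a \<in> \<alpha>"
    then show "principal P a \<subseteq> \<alpha>" using principal_subset_iff[OF assms subsetD[OF sub]] by blast
  qed
  show "\<alpha> \<subseteq> \<Union> (principal P ` \<alpha>)"
  proof
    fix a assume "a \<in> \<alpha>"
    then show "a \<in> \<Union> (principal P ` \<alpha>)" using principal_self[OF subsetD[OF sub]] by blast
  qed
qed

text \<open>
  Monotonicity of application in the form needed for realizability: a downset that receives the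
  value of an application also receives the values at all smaller arguments.
\<close>

lemma app_downset:
  assumes "a \<in> principal P a'" "b \<in> principal P b'" "a' \<in> carrier P" "b' \<in> carrier P"
    and "a' \<bullet> b' \<in> Some ` \<gamma>" "\<gamma> \<in> downsets P"
  shows "a \<bullet> b \<in> Some ` \<gamma>"
proof -
  have ab: "a \<in> carrier P" "b \<in> carrier P" "a \<sqsubseteq> a'" "b \<sqsubseteq> b'"
    using assms by (auto simp: kleisli_id_def)
  obtain c' where c': "a' \<bullet> b' = Some c'" "c' \<in> \<gamma>" using assms by auto
  then obtain c where "a \<bullet> b = Some c" "c \<sqsubseteq> c'"
    using app_mono[OF ab(1) assms(3) ab(2) assms(4) ab(3,4)] by (auto simp: defined_le_def)
  moreover have "c \<in> carrier P" using app_closed[OF ab(1,2)] calculation(1) .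
  ultimately show ?thesis using downsetsD[OF assms(6) c'(2)] by simp
qed

lemma papp_downset:
  assumes "u \<in> Some ` principal P a" "v \<in> Some ` principal P b" "a \<in> carrier P" "b \<in> carrier P"
    and "a \<bullet> b \<in> Some ` \<gamma>" "\<gamma> \<in> downsets P"
  shows "u \<odot> v \<in> Some ` \<gamma>"
  using assms(1,2) app_downset[OF _ _ assms(3-6)] by auto

lemma arr_downset:
  assumes "\<alpha> \<in> downsets P" "\<beta> \<in> downsets P"
  shows "\<alpha> \<leadsto>\<^bsub>D_alg P\<^esub> \<beta> \<in> downsets P"
proof -
  have "z \<bullet> x \<in> Some ` \<beta>"
    if a: "a \<in> \<alpha> \<leadsto>\<^bsub>D_alg P\<^esub> \<beta>" and z: "z \<in> carrier P" "z \<sqsubseteq> a" and x: "x \<in> \<alpha>" for a x z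
  proof -
    have "x \<in> carrier P" using assms x downsets_subset by fast
    moreover have "z \<in> principal P a" using z by (simp add: kleisli_id_def)
    moreover have "a \<bullet> x \<in> Some ` \<beta>" using a x by (simp add: mem_arr_D_alg)
    ultimately show ?thesis
      using app_downset[OF _ principal_self arr_D_alg_carrier[OF a] _ _ assms(2)] by blast
  qed
  then show ?thesis unfolding downsets_def by (auto simp: mem_arr_D_alg)
qed

text \<open>
  The meet is \<open>carrier P \<inter> \<Inter>X\<close>, and elements of the filter lie in the carrier anyway. This also
  covers the empty family, whose meet is the whole carrier.
\<close>

lemma Inf_D_alg_separator_iff:
  assumes "X \<subseteq> downsets P"
  shows "\<Sqinter>\<^bsub>D_alg P\<^esub> X \<in> D_filter P \<longleftrightarrow> (\<exists>e \<in> filt P. \<forall>\<alpha> \<in> X. e \<in> \<alpha>)"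
  using filt_subset carrier_Inter_downsets[OF assms] by (auto simp: Inf_D_alg[OF assms] D_filter_def)

end

section \<open>Combinatory completeness\<close>

text \<open>
  Most realizers below come from bracket abstraction. The only constants are \<open>k\<close> and \<open>s\<close>; parameters
  are passed as values of variables, so that a value lies in the filter as soon as the environment does.
\<close>

datatype comb_term = Var nat | Comb_K | Comb_S | App comb_term comb_term

primrec lam :: "nat \<Rightarrow> comb_term \<Rightarrow> comb_term" where
  "lam n (Var m) = (if m = n then App (App Comb_S Comb_K) Comb_K else App Comb_K (Var m))"
| "lam n Comb_K = App Comb_K Comb_K"
| "lam n Comb_S = App Comb_K Comb_S"
| "lam n (App t u) = App (App Comb_S (lam n t)) (lam n u)"

context pca begin

text \<open>
  The axioms on \<open>k\<close> and \<open>s\<close> bound a value by an element; the equivalent versions with membership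
  in an arbitrary downset compose without intermediate values and without transitivity of the
  order.
\<close>

definition is_K :: "'a \<Rightarrow> bool" where
  "is_K k \<longleftrightarrow> k \<in> filt P \<and> (\<forall>a \<in> carrier P. \<forall>b \<in> carrier P. k \<bullet> a \<odot> Some b \<in> Some ` principal P a)"

definition is_S :: "'a \<Rightarrow> bool" where
  "is_S s \<longleftrightarrow> s \<in> filt P
     \<and> (\<forall>a \<in> carrier P. \<forall>b \<in> carrier P. s \<bullet> a \<odot> Some b \<in> Some ` carrier P)
     \<and> (\<forall>a \<in> carrier P. \<forall>b \<in> carrier P. \<forall>c \<in> carrier P. \<forall>\<gamma> \<in> downsets P.
          (a \<bullet> c) \<odot> (b \<bullet> c) \<in> Some ` \<gamma> \<longrightarrow> s \<bullet> a \<odot> Some b \<odot> Some c \<in> Some ` \<gamma>)"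

lemma papp_closed:
  assumes "u \<in> Some ` carrier P \<or> u = None" "w \<in> Some ` carrier P \<or> w = None"
  shows "u \<odot> w \<in> Some ` carrier P \<or> u \<odot> w = None"
proof (cases "u \<odot> w")
  case (Some v)
  then obtain x y where "u = Some x" "w = Some y" "x \<bullet> y = Some v"
    by (auto simp: papp_def bind_eq_Some_conv)
  then show ?thesis using assms Some app_closed[of x y v] by auto
qed simp

lemma ex_combinators: "\<exists>k. is_K k" "\<exists>s. is_S s"
proof -
  obtain k s where ks: "k \<in> filt P" "s \<in> filt P"
    and k: "\<forall>a \<in> carrier P. \<forall>b \<in> carrier P. defined_le P (Some k \<odot> Some a \<odot> Some b) a"
    and s0: "\<forall>a \<in> carrier P. \<forall>b \<in> carrier P. Some s \<odot> Some a \<odot> Some b \<noteq> None"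
    and s: "\<forall>a \<in> carrier P. \<forall>b \<in> carrier P. \<forall>c \<in> carrier P. \<forall>v.
           Some a \<odot> Some c \<odot> (Some b \<odot> Some c) = Some v \<longrightarrow>
           defined_le P (Some s \<odot> Some a \<odot> Some b \<odot> Some c) v"
    using combinators by blast
  have car: "k \<in> carrier P" "s \<in> carrier P" using ks filt_subset by auto
  have "k \<bullet> a \<odot> Some b \<in> Some ` principal P a"
    if ab: "a \<in> carrier P" "b \<in> carrier P" for a b
  proof -
    have "Some k \<odot> Some a \<odot> Some b \<in> Some ` carrier P \<or> Some k \<odot> Some a \<odot> Some b = None"
      using ab car by (intro papp_closed) auto
    then show ?thesis using k[rule_format, OF ab] by (force simp: defined_le_def kleisli_id_def)
  qed
  then show "\<exists>k. is_K k" using ks unfolding is_K_def by blast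
  have "s \<bullet> a \<odot> Some b \<in> Some ` carrier P" if ab: "a \<in> carrier P" "b \<in> carrier P" for a b
  proof -
    have "Some s \<odot> Some a \<odot> Some b \<in> Some ` carrier P \<or> Some s \<odot> Some a \<odot> Some b = None"
      using ab car by (intro papp_closed) auto
    then show ?thesis using s0[rule_format, OF ab] by auto
  qed
  moreover have "s \<bullet> a \<odot> Some b \<odot> Some c \<in> Some ` \<gamma>"
    if abc: "a \<in> carrier P" "b \<in> carrier P" "c \<in> carrier P"
      and \<gamma>: "\<gamma> \<in> downsets P" and v: "(a \<bullet> c) \<odot> (b \<bullet> c) \<in> Some ` \<gamma>" for a b c \<gamma>
  proof -
    have "Some s \<odot> Some a \<odot> Some b \<odot> Some c \<in> Some ` carrier P
        \<or> Some s \<odot> Some a \<odot> Some b \<odot> Some c = None"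
      using abc car by (intro papp_closed) auto
    moreover obtain v where v: "Some a \<odot> Some c \<odot> (Some b \<odot> Some c) = Some v" "v \<in> \<gamma>"
      using v by auto
    then have "defined_le P (Some s \<odot> Some a \<odot> Some b \<odot> Some c) v" using s abc by blast
    ultimately show ?thesis using downsetsD[OF \<gamma> v(2)] by (auto simp: defined_le_def)
  qed
  ultimately show "\<exists>s. is_S s" using ks unfolding is_S_def by blast
qed

definition k_elem :: 'a where "k_elem = (SOME k. is_K k)"
definition s_elem :: 'a where "s_elem = (SOME s. is_S s)"

lemma k_elem: "is_K k_elem" and s_elem: "is_S s_elem"
  unfolding k_elem_def s_elem_def using ex_combinators by (auto intro: someI_ex)

lemma k_elem_filt: "k_elem \<in> filt P" and s_elem_filt: "s_elem \<in> filt P"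
  using k_elem s_elem by (auto simp: is_K_def is_S_def)

lemma k_elem_carrier: "k_elem \<in> carrier P" and s_elem_carrier: "s_elem \<in> carrier P"
  using k_elem_filt s_elem_filt filt_subset by auto

lemma k_elem_app2: "\<lbrakk>a \<in> carrier P; b \<in> carrier P\<rbrakk> \<Longrightarrow> k_elem \<bullet> a \<odot> Some b \<in> Some ` principal P a"
  using k_elem by (simp add: is_K_def)

lemma s_elem_app2: "\<lbrakk>a \<in> carrier P; b \<in> carrier P\<rbrakk> \<Longrightarrow> s_elem \<bullet> a \<odot> Some b \<in> Some ` carrier P"
  using s_elem by (simp add: is_S_def)

lemma s_elem_app3:
  "\<lbrakk>(a \<bullet> c) \<odot> (b \<bullet> c) \<in> Some ` \<gamma>; a \<in> carrier P; b \<in> carrier P; c \<in> carrier P; \<gamma> \<in> downsets P\<rbrakk>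
    \<Longrightarrow> s_elem \<bullet> a \<odot> Some b \<odot> Some c \<in> Some ` \<gamma>"
  using s_elem by (simp add: is_S_def)

lemma k_elem_app1: "a \<in> carrier P \<Longrightarrow> k_elem \<bullet> a \<in> Some ` carrier P"
  using k_elem_app2[of a a] app_closed[OF k_elem_carrier, of a]
  by (cases "k_elem \<bullet> a") (simp_all add: papp_def image_iff)

lemma k_elem_app2_downset:
  assumes "b \<in> \<gamma>" "\<gamma> \<in> downsets P" "a \<in> carrier P"
  shows "k_elem \<bullet> b \<odot> Some a \<in> Some ` \<gamma>"
proof -
  have b: "b \<in> carrier P" using assms downsets_subset by fast
  then have "principal P b \<subseteq> \<gamma>" using assms principal_subset_iff by simp
  then show ?thesis using k_elem_app2[OF b assms(3)] by (rule subsetD[OF image_mono])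
qed

primrec eval :: "(nat \<Rightarrow> 'a) \<Rightarrow> comb_term \<Rightarrow> 'a option" where
  "eval \<rho> (Var n) = Some (\<rho> n)"
| "eval \<rho> Comb_K = Some k_elem"
| "eval \<rho> Comb_S = Some s_elem"
| "eval \<rho> (App t u) = eval \<rho> t \<odot> eval \<rho> u"

text \<open>
  The set \<open>T\<close> is a parameter because two instances matter: the carrier and the filter.
\<close>

lemma eval_closed:
  assumes "eval \<rho> t = Some v" "range \<rho> \<subseteq> T" "k_elem \<in> T" "s_elem \<in> T"
    and T: "\<And>a b c. \<lbrakk>a \<in> T; b \<in> T; a \<bullet> b = Some c\<rbrakk> \<Longrightarrow> c \<in> T"
  shows "v \<in> T"
  using assms(1)
proof (induction t arbitrary: v)
  case (App t u)
  then obtain x y where "eval \<rho> t = Some x" "eval \<rho> u = Some y" "x \<bullet> y = Some v"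
    by (auto simp: papp_def bind_eq_Some_conv)
  then show ?case using App.IH T by blast
next
  case (Var n)
  then show ?case using assms(2) by auto
qed (use assms(3,4) in simp_all)

lemma eval_carrier: "\<lbrakk>eval \<rho> t = Some v; range \<rho> \<subseteq> carrier P\<rbrakk> \<Longrightarrow> v \<in> carrier P"
  by (rule eval_closed[OF _ _ k_elem_carrier s_elem_carrier app_closed])

lemma eval_filt: "\<lbrakk>eval \<rho> t = Some v; range \<rho> \<subseteq> filt P\<rbrakk> \<Longrightarrow> v \<in> filt P"
  by (rule eval_closed[OF _ _ k_elem_filt s_elem_filt filt_app])

text \<open>
  An abstraction is always defined, even if its body is not: \<open>k a\<close> and \<open>s a b\<close> are. This totality
  matters for realizers of \<open>\<alpha> \<leadsto> \<beta> \<leadsto> \<gamma>\<close> with \<open>\<beta>\<close> empty, which must still be defined at every element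
  of \<open>\<alpha>\<close>.
\<close>

lemma eval_lam_defined:
  assumes "range \<rho> \<subseteq> carrier P"
  shows "eval \<rho> (lam n t) \<in> Some ` carrier P"
proof (induction t)
  case (Var m)
  have "\<rho> m \<in> carrier P" using assms by auto
  then show ?case by (simp add: k_elem_app1 s_elem_app2 k_elem_carrier)
next
  case (App t u)
  then obtain v w where "eval \<rho> (lam n t) = Some v" "eval \<rho> (lam n u) = Some w"
    "v \<in> carrier P" "w \<in> carrier P" by auto
  then show ?case by (simp add: s_elem_app2)
qed (simp_all add: k_elem_app1 k_elem_carrier s_elem_carrier)

text \<open>
  At an application, both immediate subterms are first evaluated in the principal downsets of their
  intended values; monotonicity of application then transfers the bound to the whole term.
\<close>

lemma eval_lam_beta:
  assumes r: "range \<rho> \<subseteq> carrier P" and a: "a \<in> carrier P" and "\<gamma> \<in> downsets P"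
    and "eval (\<rho>(n := a)) t \<in> Some ` \<gamma>"
  shows "eval \<rho> (lam n t) \<odot> Some a \<in> Some ` \<gamma>"
  using assms(3,4)
proof (induction t arbitrary: \<gamma>)
  case (App t u)
  have rc: "range (\<rho>(n := a)) \<subseteq> carrier P" using r a by auto
  obtain v w where vw: "eval (\<rho>(n := a)) t = Some v" "eval (\<rho>(n := a)) u = Some w"
    and \<gamma>: "v \<bullet> w \<in> Some ` \<gamma>"
    using App.prems(2) unfolding eval.simps papp_in_image_iff by blast
  have c: "v \<in> carrier P" "w \<in> carrier P" using eval_carrier[OF _ rc] vw by auto
  obtain v' w' where vw': "eval \<rho> (lam n t) = Some v'" "eval \<rho> (lam n u) = Some w'"
    "v' \<in> carrier P" "w' \<in> carrier P"
    using eval_lam_defined[OF r, of n t] eval_lam_defined[OF r, of n u] by auto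
  have "v' \<bullet> a \<in> Some ` principal P v" "w' \<bullet> a \<in> Some ` principal P w"
    using App.IH(1)[OF principal_downset[OF c(1)]] App.IH(2)[OF principal_downset[OF c(2)]]
      principal_self[OF c(1)] principal_self[OF c(2)]
    unfolding vw vw' papp_Some by blast+
  then have "(v' \<bullet> a) \<odot> (w' \<bullet> a) \<in> Some ` \<gamma>"
    by (rule papp_downset[OF _ _ c \<gamma> App.prems(1)])
  then have "s_elem \<bullet> v' \<odot> Some w' \<odot> Some a \<in> Some ` \<gamma>"
    by (rule s_elem_app3[OF _ vw'(3,4) a App.prems(1)])
  then show ?case using vw' by simp
next
  case (Var m)
  have "s_elem \<bullet> k_elem \<odot> Some k_elem \<odot> Some a \<in> Some ` \<gamma>" if "a \<in> \<gamma>"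
  proof (rule s_elem_app3[OF _ k_elem_carrier k_elem_carrier a Var.prems(1)])
    obtain b where "k_elem \<bullet> a = Some b" "b \<in> carrier P" using k_elem_app1[OF a] by auto
    then show "(k_elem \<bullet> a) \<odot> (k_elem \<bullet> a) \<in> Some ` \<gamma>"
      using k_elem_app2_downset[OF that Var.prems(1)] by simp
  qed
  then show ?case using Var.prems k_elem_app2_downset[OF _ Var.prems(1) a, of "\<rho> m"]
    by (simp add: inj_image_mem_iff split: if_splits)
next
  case Comb_K
  then have "k_elem \<in> \<gamma>" by (simp add: inj_image_mem_iff)
  then show ?case using k_elem_app2_downset[OF _ Comb_K(1) a] by simp
next
  case Comb_S
  then have "s_elem \<in> \<gamma>" by (simp add: inj_image_mem_iff)
  then show ?case using k_elem_app2_downset[OF _ Comb_S(1) a] by simp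
qed

text \<open>
  The introduction rule of the arrow. Together with \<open>papp_arr\<close>, its elimination rule, it makes
  simple typing of a lambda term a proof that the term realizes its type.
\<close>

lemma eval_lam_arr:
  assumes r: "range \<rho> \<subseteq> carrier P" and "\<alpha> \<in> downsets P" "\<beta> \<in> downsets P"
    and t: "\<And>a. a \<in> \<alpha> \<Longrightarrow> eval (\<rho>(n := a)) t \<in> Some ` \<beta>"
  shows "eval \<rho> (lam n t) \<in> Some ` (\<alpha> \<leadsto>\<^bsub>D_alg P\<^esub> \<beta>)"
proof -
  obtain v where v: "eval \<rho> (lam n t) = Some v" "v \<in> carrier P"
    using eval_lam_defined[OF r, of n t] by auto
  have "v \<bullet> a \<in> Some ` \<beta>" if "a \<in> \<alpha>" for a
    using eval_lam_beta[OF r _ assms(3) t[OF that]] downsets_subset[OF assms(2)] that v by auto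
  then show ?thesis using v by (simp add: mem_arr_D_alg inj_image_mem_iff)
qed

lemma papp_arr:
  "\<lbrakk>u \<in> Some ` (\<alpha> \<leadsto>\<^bsub>D_alg P\<^esub> \<beta>); w \<in> Some ` \<alpha>\<rbrakk> \<Longrightarrow> u \<odot> w \<in> Some ` \<beta>"
  by (auto simp: mem_arr_D_alg)

lemma eval_lam_filt:
  assumes "range \<rho> \<subseteq> filt P"
  obtains e where "eval \<rho> (lam n t) = Some e" "e \<in> filt P"
  using eval_lam_defined[of \<rho> n t] eval_filt[OF _ assms, of "lam n t"] assms filt_subset by blast

section \<open>The arrow algebra of downsets\<close>

lemma ex_identity_realizer: "\<exists>i \<in> filt P. \<forall>\<alpha> \<in> downsets P. i \<in> \<alpha> \<leadsto>\<^bsub>D_alg P\<^esub> \<alpha>"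
proof -
  have r: "range (\<lambda>_. k_elem) \<subseteq> filt P" "range (\<lambda>_. k_elem) \<subseteq> carrier P"
    using k_elem_filt k_elem_carrier by auto
  obtain i where i: "eval (\<lambda>_. k_elem) (lam 0 (Var 0)) = Some i" "i \<in> filt P"
    using eval_lam_filt[OF r(1)] .
  moreover have "eval (\<lambda>_. k_elem) (lam 0 (Var 0)) \<in> Some ` (\<alpha> \<leadsto>\<^bsub>D_alg P\<^esub> \<alpha>)"
    if "\<alpha> \<in> downsets P" for \<alpha>
    using that by (intro eval_lam_arr r) auto
  ultimately show ?thesis by (metis inj_Some inj_image_mem_iff)
qed

text \<open>
  One element serves all \<open>\<alpha>\<close>, \<open>\<beta>\<close>, \<open>\<gamma>\<close>; this uniformity is what makes entailment over an index
  set transitive.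
\<close>

lemma ex_composition_realizer:
  assumes "p \<in> filt P" "q \<in> filt P"
  shows "\<exists>e \<in> filt P. \<forall>\<alpha> \<in> downsets P. \<forall>\<beta> \<in> downsets P. \<forall>\<gamma> \<in> downsets P.
    p \<in> \<alpha> \<leadsto>\<^bsub>D_alg P\<^esub> \<beta> \<longrightarrow> q \<in> \<beta> \<leadsto>\<^bsub>D_alg P\<^esub> \<gamma> \<longrightarrow> e \<in> \<alpha> \<leadsto>\<^bsub>D_alg P\<^esub> \<gamma>"
proof -
  define \<rho> where "\<rho> = (\<lambda>_ :: nat. p)(1 := q)"
  let ?t = "lam 0 (App (Var 1) (App (Var 2) (Var 0)))"
  have r: "range \<rho> \<subseteq> filt P" "range \<rho> \<subseteq> carrier P"
    using assms filt_subset by (auto simp: \<rho>_def)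
  obtain e where e: "eval \<rho> ?t = Some e" "e \<in> filt P" using eval_lam_filt[OF r(1)] .
  have "eval \<rho> ?t \<in> Some ` (\<alpha> \<leadsto>\<^bsub>D_alg P\<^esub> \<gamma>)"
    if "\<alpha> \<in> downsets P" "\<beta> \<in> downsets P" "\<gamma> \<in> downsets P"
      and pq: "p \<in> \<alpha> \<leadsto>\<^bsub>D_alg P\<^esub> \<beta>" "q \<in> \<beta> \<leadsto>\<^bsub>D_alg P\<^esub> \<gamma>" for \<alpha> \<beta> \<gamma>
  proof (rule eval_lam_arr[OF r(2) that(1,3)])
    fix a assume "a \<in> \<alpha>"
    then have "p \<bullet> a \<in> Some ` \<beta>" using pq by (simp add: mem_arr_D_alg)
    then show "eval (\<rho>(0 := a)) (App (Var 1) (App (Var 2) (Var 0))) \<in> Some ` \<gamma>"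
      using pq by (auto simp: \<rho>_def mem_arr_D_alg)
  qed
  then show ?thesis using e by (metis inj_Some inj_image_mem_iff)
qed

text \<open>
  The element \<open>t\<close> itself need not belong to \<open>\<alpha> \<leadsto> \<beta> \<leadsto> \<gamma>\<close>: if \<open>\<beta>\<close> is empty, the hypothesis does not
  make \<open>t x\<close> defined. Its expansion \<open>\<lambda>x y. t x y\<close> is defined at every first argument.
\<close>

lemma ex_curried_realizer:
  assumes "t \<in> filt P"
  shows "\<exists>e \<in> filt P. \<forall>\<alpha> \<in> downsets P. \<forall>\<beta> \<in> downsets P. \<forall>\<gamma> \<in> downsets P.
    (\<forall>x \<in> \<alpha>. \<forall>y \<in> \<beta>. t \<bullet> x \<odot> Some y \<in> Some ` \<gamma>) \<longrightarrow> e \<in> \<alpha> \<leadsto>\<^bsub>D_alg P\<^esub> \<beta> \<leadsto>\<^bsub>D_alg P\<^esub> \<gamma>"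
proof -
  define \<rho> where "\<rho> = (\<lambda>_ :: nat. t)"
  let ?u = "App (App (Var 2) (Var 0)) (Var 1)"
  have r: "range \<rho> \<subseteq> filt P" "range \<rho> \<subseteq> carrier P"
    using assms filt_subset by (auto simp: \<rho>_def)
  obtain e where e: "eval \<rho> (lam 0 (lam 1 ?u)) = Some e" "e \<in> filt P"
    using eval_lam_filt[OF r(1)] .
  have "eval \<rho> (lam 0 (lam 1 ?u)) \<in> Some ` (\<alpha> \<leadsto>\<^bsub>D_alg P\<^esub> \<beta> \<leadsto>\<^bsub>D_alg P\<^esub> \<gamma>)"
    if D: "\<alpha> \<in> downsets P" "\<beta> \<in> downsets P" "\<gamma> \<in> downsets P"
      and t: "\<forall>x \<in> \<alpha>. \<forall>y \<in> \<beta>. t \<bullet> x \<odot> Some y \<in> Some ` \<gamma>" for \<alpha> \<beta> \<gamma>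
  proof (intro eval_lam_arr arr_downset D r)
    fix a assume a: "a \<in> \<alpha>"
    show "range (\<rho>(0 := a)) \<subseteq> carrier P" using a downsets_subset[OF D(1)] r(2) by auto
    fix b assume b: "b \<in> \<beta>"
    show "eval (\<rho>(0 := a, 1 := b)) ?u \<in> Some ` \<gamma>" using t a b by (simp add: \<rho>_def)
  qed
  then show ?thesis using e by (metis inj_Some inj_image_mem_iff)
qed

lemma comb_k_D_alg: "comb_k (D_alg P) \<in> D_filter P"
proof -
  let ?X = "{\<alpha> \<leadsto>\<^bsub>D_alg P\<^esub> \<beta> \<leadsto>\<^bsub>D_alg P\<^esub> \<alpha> | \<alpha> \<beta>. \<alpha> \<in> downsets P \<and> \<beta> \<in> downsets P}"
  have r: "range (\<lambda>_. k_elem) \<subseteq> filt P" "range (\<lambda>_. k_elem) \<subseteq> carrier P"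
    using k_elem_filt k_elem_carrier by auto
  have "?X \<subseteq> downsets P" by (auto intro!: arr_downset)
  moreover have "\<exists>e \<in> filt P. \<forall>\<xi> \<in> ?X. e \<in> \<xi>"
  proof (rule bexI[OF _ k_elem_filt], intro ballI)
    fix \<xi> assume "\<xi> \<in> ?X"
    then obtain \<alpha> \<beta> where \<xi>: "\<xi> = \<alpha> \<leadsto>\<^bsub>D_alg P\<^esub> \<beta> \<leadsto>\<^bsub>D_alg P\<^esub> \<alpha>" "\<alpha> \<in> downsets P" "\<beta> \<in> downsets P"
      by blast
    have "k_elem \<bullet> a \<in> Some ` (\<beta> \<leadsto>\<^bsub>D_alg P\<^esub> \<alpha>)" if a: "a \<in> \<alpha>" for a
    proof -
      obtain v where "k_elem \<bullet> a = Some v" "v \<in> carrier P"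
        using k_elem_app1[of a] a downsets_subset[OF \<xi>(2)] by auto
      moreover have "k_elem \<bullet> a \<odot> Some b \<in> Some ` \<alpha>" if "b \<in> \<beta>" for b
        using k_elem_app2_downset[OF a \<xi>(2)] that downsets_subset[OF \<xi>(3)] by blast
      ultimately show ?thesis by (simp add: mem_arr_D_alg inj_image_mem_iff)
    qed
    then show "k_elem \<in> \<xi>" by (simp add: \<xi>(1) mem_arr_D_alg k_elem_carrier)
  qed
  ultimately show ?thesis unfolding comb_k_def D_alg_simps by (rule Inf_D_alg_separator_iff[THEN iffD2])
qed

lemma comb_s_D_alg: "comb_s (D_alg P) \<in> D_filter P"
proof -
  let ?X = "{(\<alpha> \<leadsto>\<^bsub>D_alg P\<^esub> \<beta> \<leadsto>\<^bsub>D_alg P\<^esub> \<gamma>) \<leadsto>\<^bsub>D_alg P\<^esub> (\<alpha> \<leadsto>\<^bsub>D_alg P\<^esub> \<beta>) \<leadsto>\<^bsub>D_alg P\<^esub> \<alpha> \<leadsto>\<^bsub>D_alg P\<^esub> \<gamma>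
      | \<alpha> \<beta> \<gamma>. \<alpha> \<in> downsets P \<and> \<beta> \<in> downsets P \<and> \<gamma> \<in> downsets P}"
  let ?\<rho> = "\<lambda>_ :: nat. k_elem"
  let ?t = "App (App (Var 0) (Var 2)) (App (Var 1) (Var 2))"
  have r: "range ?\<rho> \<subseteq> filt P" "range ?\<rho> \<subseteq> carrier P"
    using k_elem_filt k_elem_carrier by auto
  obtain e where e: "eval ?\<rho> (lam 0 (lam 1 (lam 2 ?t))) = Some e" "e \<in> filt P"
    using eval_lam_filt[OF r(1)] .
  have "?X \<subseteq> downsets P" by (auto intro!: arr_downset)
  moreover have "e \<in> \<xi>" if "\<xi> \<in> ?X" for \<xi>
  proof -
    obtain \<alpha> \<beta> \<gamma> where D: "\<alpha> \<in> downsets P" "\<beta> \<in> downsets P" "\<gamma> \<in> downsets P" and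
      \<xi>: "\<xi> = (\<alpha> \<leadsto>\<^bsub>D_alg P\<^esub> \<beta> \<leadsto>\<^bsub>D_alg P\<^esub> \<gamma>) \<leadsto>\<^bsub>D_alg P\<^esub> (\<alpha> \<leadsto>\<^bsub>D_alg P\<^esub> \<beta>) \<leadsto>\<^bsub>D_alg P\<^esub> \<alpha> \<leadsto>\<^bsub>D_alg P\<^esub> \<gamma>"
      using \<open>\<xi> \<in> ?X\<close> by blast
    have "eval ?\<rho> (lam 0 (lam 1 (lam 2 ?t))) \<in> Some ` \<xi>"
      unfolding \<xi>
    proof (intro eval_lam_arr arr_downset D r)
      fix x assume x: "x \<in> \<alpha> \<leadsto>\<^bsub>D_alg P\<^esub> \<beta> \<leadsto>\<^bsub>D_alg P\<^esub> \<gamma>"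
      show r1: "range (?\<rho>(0 := x)) \<subseteq> carrier P"
        using arr_D_alg_carrier[OF x] k_elem_carrier by auto
      fix y assume y: "y \<in> \<alpha> \<leadsto>\<^bsub>D_alg P\<^esub> \<beta>"
      show "range (?\<rho>(0 := x, 1 := y)) \<subseteq> carrier P"
        using arr_D_alg_carrier[OF y] r1 by auto
      fix z assume z: "z \<in> \<alpha>"
      have "(x \<bullet> z) \<odot> (y \<bullet> z) \<in> Some ` \<gamma>"
        using x y z by (intro papp_arr[of _ \<beta>]) (simp_all add: mem_arr_D_alg)
      then show "eval (?\<rho>(0 := x, 1 := y, 2 := z)) ?t \<in> Some ` \<gamma>" by simp
    qed
    then show ?thesis using e by (simp add: inj_image_mem_iff)
  qed
  ultimately show ?thesis
    unfolding comb_s_def D_alg_simps using e(2) by (intro Inf_D_alg_separator_iff[THEN iffD2]) blast+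
qed

text \<open>
  The realizer is \<open>\<lambda>x y z. x y z\<close> rather than the identity. For the empty family both meets are the
  whole carrier, and a realizer of \<open>carrier P \<leadsto> \<alpha> \<leadsto> carrier P\<close> must be defined at any two arguments
  even if these cannot be applied to one another.
\<close>

lemma comb_a_D_alg: "comb_a (D_alg P) \<in> D_filter P"
proof -
  let ?L = "\<lambda>\<alpha> Z. {\<alpha> \<leadsto>\<^bsub>D_alg P\<^esub> \<beta> \<leadsto>\<^bsub>D_alg P\<^esub> \<gamma> | \<beta> \<gamma>. (\<beta>, \<gamma>) \<in> Z}"
  let ?R = "\<lambda>Z. {\<beta> \<leadsto>\<^bsub>D_alg P\<^esub> \<gamma> | \<beta> \<gamma>. (\<beta>, \<gamma>) \<in> Z}"
  let ?X = "{(\<Sqinter>\<^bsub>D_alg P\<^esub> ?L \<alpha> Z) \<leadsto>\<^bsub>D_alg P\<^esub> \<alpha> \<leadsto>\<^bsub>D_alg P\<^esub> (\<Sqinter>\<^bsub>D_alg P\<^esub> ?R Z)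
      | \<alpha> Z. \<alpha> \<in> downsets P \<and> Z \<subseteq> downsets P \<times> downsets P}"
  let ?\<rho> = "\<lambda>_ :: nat. k_elem"
  let ?t = "App (App (Var 0) (Var 1)) (Var 2)"
  have r: "range ?\<rho> \<subseteq> filt P" "range ?\<rho> \<subseteq> carrier P"
    using k_elem_filt k_elem_carrier by auto
  obtain e where e: "eval ?\<rho> (lam 0 (lam 1 (lam 2 ?t))) = Some e" "e \<in> filt P"
    using eval_lam_filt[OF r(1)] .
  have L: "?L \<alpha> Z \<subseteq> downsets P" and R: "?R Z \<subseteq> downsets P"
    if "\<alpha> \<in> downsets P" "Z \<subseteq> downsets P \<times> downsets P" for \<alpha> Z
    using that by (auto intro!: arr_downset)
  have Inf_down: "\<Sqinter>\<^bsub>D_alg P\<^esub> Y \<in> downsets P" if "Y \<subseteq> downsets P" for Y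
    using Inf_D_alg[OF that] carrier_Inter_downsets[OF that] by simp
  have "?X \<subseteq> downsets P"
  proof
    fix \<xi> assume "\<xi> \<in> ?X"
    then obtain \<alpha> Z where D: "\<alpha> \<in> downsets P" "Z \<subseteq> downsets P \<times> downsets P"
      and \<xi>: "\<xi> = (\<Sqinter>\<^bsub>D_alg P\<^esub> ?L \<alpha> Z) \<leadsto>\<^bsub>D_alg P\<^esub> \<alpha> \<leadsto>\<^bsub>D_alg P\<^esub> (\<Sqinter>\<^bsub>D_alg P\<^esub> ?R Z)" by blast
    show "\<xi> \<in> downsets P" unfolding \<xi> by (intro arr_downset Inf_down D L[OF D] R[OF D])
  qed
  moreover have "e \<in> \<xi>" if "\<xi> \<in> ?X" for \<xi>
  proof -
    obtain \<alpha> Z where D: "\<alpha> \<in> downsets P" "Z \<subseteq> downsets P \<times> downsets P"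
      and \<xi>: "\<xi> = (\<Sqinter>\<^bsub>D_alg P\<^esub> ?L \<alpha> Z) \<leadsto>\<^bsub>D_alg P\<^esub> \<alpha> \<leadsto>\<^bsub>D_alg P\<^esub> (\<Sqinter>\<^bsub>D_alg P\<^esub> ?R Z)"
      using \<open>\<xi> \<in> ?X\<close> by blast
    have "eval ?\<rho> (lam 0 (lam 1 (lam 2 ?t))) \<in> Some ` \<xi>"
      unfolding \<xi>
    proof (intro eval_lam_arr arr_downset Inf_down D L[OF D] R[OF D] r)
      fix x assume x: "x \<in> \<Sqinter>\<^bsub>D_alg P\<^esub> ?L \<alpha> Z"
      have xL: "x \<in> carrier P" "\<And>\<beta> \<gamma>. (\<beta>, \<gamma>) \<in> Z \<Longrightarrow> x \<in> \<alpha> \<leadsto>\<^bsub>D_alg P\<^esub> \<beta> \<leadsto>\<^bsub>D_alg P\<^esub> \<gamma>"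
        using x unfolding Inf_D_alg[OF L[OF D]] by auto
      show rx: "range (?\<rho>(0 := x)) \<subseteq> carrier P" using xL k_elem_carrier by auto
      fix y assume y: "y \<in> \<alpha>"
      have rxy: "range (?\<rho>(0 := x, 1 := y)) \<subseteq> carrier P"
        using xL k_elem_carrier y downsets_subset[OF D(1)] by auto
  \<comment> \<open>The value is fixed before the members of the family, since it has to lie in all of them.\<close>
      obtain v where v: "eval (?\<rho>(0 := x, 1 := y)) (lam 2 ?t) = Some v" "v \<in> carrier P"
        using eval_lam_defined[OF rxy, of 2 ?t] by blast
      have "v \<in> \<beta> \<leadsto>\<^bsub>D_alg P\<^esub> \<gamma>" if Z: "(\<beta>, \<gamma>) \<in> Z" for \<beta> \<gamma>
      proof -
        have "eval (?\<rho>(0 := x, 1 := y)) (lam 2 ?t) \<in> Some ` (\<beta> \<leadsto>\<^bsub>D_alg P\<^esub> \<gamma>)"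
        proof (rule eval_lam_arr[OF rxy])
          show "\<beta> \<in> downsets P" "\<gamma> \<in> downsets P" using Z D(2) by auto
          fix z assume z: "z \<in> \<beta>"
          have "x \<bullet> y \<odot> Some z \<in> Some ` \<gamma>"
            using xL(2)[OF Z] y z by (intro papp_arr[of _ \<beta>]) (simp_all add: mem_arr_D_alg)
          then show "eval (?\<rho>(0 := x, 1 := y, 2 := z)) ?t \<in> Some ` \<gamma>" by simp
        qed
        then show ?thesis using v by (simp add: inj_image_mem_iff)
      qed
      then show "eval (?\<rho>(0 := x, 1 := y)) (lam 2 ?t) \<in> Some ` (\<Sqinter>\<^bsub>D_alg P\<^esub> ?R Z)"
        using v unfolding Inf_D_alg[OF R[OF D]] by auto
    qed
    then show ?thesis using e by (simp add: inj_image_mem_iff)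
  qed
  ultimately show ?thesis
    unfolding comb_a_def D_alg_simps using e(2) by (intro Inf_D_alg_separator_iff[THEN iffD2]) blast+
qed

theorem arrow_algebra_D_alg: "arrow_algebra (D_alg P)"
proof (intro arrow_algebra.intro arrow_algebra_axioms.intro partial_order_D_alg; (unfold D_alg_simps)?)
  show "\<exists>m. is_glb (D_alg P) m X" if "X \<subseteq> downsets P" for X
    using is_glb_D_alg[OF that] by blast
  show "D_filter P \<subseteq> downsets P" by (auto simp: D_filter_def)
  show "\<beta> \<in> D_filter P" if "\<alpha> \<in> D_filter P" "\<beta> \<in> downsets P" "\<alpha> \<subseteq> \<beta>" for \<alpha> \<beta>
    using that by (auto simp: D_filter_def)
  show "\<beta> \<in> D_filter P"
    if \<beta>: "\<beta> \<in> downsets P" and mp: "\<alpha> \<leadsto>\<^bsub>D_alg P\<^esub> \<beta> \<in> D_filter P" "\<alpha> \<in> D_filter P" for \<alpha> \<beta>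
  proof -
    obtain e x where ex: "e \<in> \<alpha> \<leadsto>\<^bsub>D_alg P\<^esub> \<beta>" "x \<in> \<alpha>" and filt: "e \<in> filt P" "x \<in> filt P"
      using mp unfolding D_filter_def by blast
    obtain v where "e \<bullet> x = Some v" "v \<in> \<beta>" by (rule arr_D_algE[OF ex])
    then show ?thesis using \<beta> filt_app[OF filt] by (auto simp: D_filter_def)
  qed
  show "\<alpha> \<leadsto>\<^bsub>D_alg P\<^esub> \<beta> \<subseteq> \<alpha>' \<leadsto>\<^bsub>D_alg P\<^esub> \<beta>'" if "\<alpha>' \<subseteq> \<alpha>" "\<beta> \<subseteq> \<beta>'" for \<alpha> \<alpha>' \<beta> \<beta>'
    using that by (rule arr_D_alg_mono)
qed (use arr_downset comb_k_D_alg comb_s_D_alg comb_a_D_alg in auto)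

section \<open>Realizers for entailments and existential quantification\<close>

lemma entails_D_alg_iff:
  assumes "\<phi> \<in> I \<rightarrow> downsets P" "\<psi> \<in> I \<rightarrow> downsets P"
  shows "entails (D_alg P) I \<phi> \<psi> \<longleftrightarrow> (\<exists>e \<in> filt P. \<forall>i \<in> I. e \<in> \<phi> i \<leadsto>\<^bsub>D_alg P\<^esub> \<psi> i)"
proof -
  have "{\<phi> i \<leadsto>\<^bsub>D_alg P\<^esub> \<psi> i | i. i \<in> I} \<subseteq> downsets P"
    using assms by (auto intro!: arr_downset)
  then show ?thesis unfolding entails_def D_alg_simps by (subst Inf_D_alg_separator_iff) auto
qed

lemma entails_D_alg_refl: "\<phi> \<in> I \<rightarrow> downsets P \<Longrightarrow> entails (D_alg P) I \<phi> \<phi>"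
  using ex_identity_realizer by (fastforce simp: entails_D_alg_iff Pi_iff)

lemma entails_D_alg_trans:
  assumes "entails (D_alg P) I \<phi> \<psi>" "entails (D_alg P) I \<psi> \<chi>"
    and D: "\<phi> \<in> I \<rightarrow> downsets P" "\<psi> \<in> I \<rightarrow> downsets P" "\<chi> \<in> I \<rightarrow> downsets P"
  shows "entails (D_alg P) I \<phi> \<chi>"
proof -
  obtain p q where "p \<in> filt P" "q \<in> filt P" and p: "\<forall>i \<in> I. p \<in> \<phi> i \<leadsto>\<^bsub>D_alg P\<^esub> \<psi> i"
    and q: "\<forall>i \<in> I. q \<in> \<psi> i \<leadsto>\<^bsub>D_alg P\<^esub> \<chi> i"
    using assms by (auto simp: entails_D_alg_iff)
  then obtain e where "e \<in> filt P" and e: "\<forall>\<alpha> \<in> downsets P. \<forall>\<beta> \<in> downsets P. \<forall>\<gamma> \<in> downsets P.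
      p \<in> \<alpha> \<leadsto>\<^bsub>D_alg P\<^esub> \<beta> \<longrightarrow> q \<in> \<beta> \<leadsto>\<^bsub>D_alg P\<^esub> \<gamma> \<longrightarrow> e \<in> \<alpha> \<leadsto>\<^bsub>D_alg P\<^esub> \<gamma>"
    using ex_composition_realizer by blast
  have "e \<in> \<phi> i \<leadsto>\<^bsub>D_alg P\<^esub> \<chi> i" if i: "i \<in> I" for i
    using e[rule_format, of "\<phi> i" "\<psi> i" "\<chi> i"] p q i D by (simp add: Pi_iff)
  then show ?thesis using \<open>e \<in> filt P\<close> D by (auto simp: entails_D_alg_iff)
qed

end

definition fibre_union :: "'i set \<Rightarrow> ('i \<Rightarrow> 'j) \<Rightarrow> ('i \<Rightarrow> 'a set) \<Rightarrow> 'j \<Rightarrow> 'a set" where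
  "fibre_union X g \<alpha> y = \<Union> (\<alpha> ` {x \<in> X. g x = y})"

context pca begin

lemma fibre_union_downsets:
  "\<alpha> \<in> X \<rightarrow> downsets P \<Longrightarrow> fibre_union X g \<alpha> \<in> Y \<rightarrow> downsets P"
  unfolding fibre_union_def by (intro Pi_I Union_downsets) auto

text \<open>
  The same elements realize both sides of the adjunction, because mapping a union into \<open>\<psi> y\<close> means
  mapping each of its members there.
\<close>

lemma is_exists_along_fibre_union:
  assumes g: "g \<in> X \<rightarrow> Y"
  shows "is_exists_along (D_alg P) X Y g (fibre_union X g)"
  unfolding is_exists_along_def D_alg_simps
proof (intro conjI ballI)
  show "fibre_union X g \<in> (X \<rightarrow> downsets P) \<rightarrow> (Y \<rightarrow> downsets P)"
    by (rule Pi_I) (rule fibre_union_downsets)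
  fix \<alpha> \<psi> assume \<alpha>: "\<alpha> \<in> X \<rightarrow> downsets P" and \<psi>: "\<psi> \<in> Y \<rightarrow> downsets P"
  have \<psi>g: "\<psi> \<circ> g \<in> X \<rightarrow> downsets P" using \<psi> g by auto
  have "(\<forall>y \<in> Y. e \<in> fibre_union X g \<alpha> y \<leadsto>\<^bsub>D_alg P\<^esub> \<psi> y)
      \<longleftrightarrow> (\<forall>x \<in> X. e \<in> \<alpha> x \<leadsto>\<^bsub>D_alg P\<^esub> (\<psi> \<circ> g) x)" if "e \<in> filt P" for e
    using g that filt_subset by (auto simp: fibre_union_def mem_arr_D_alg Pi_iff)
  then show "entails (D_alg P) Y (fibre_union X g \<alpha>) \<psi> \<longleftrightarrow> entails (D_alg P) X \<alpha> (\<psi> \<circ> g)"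
    unfolding entails_D_alg_iff[OF fibre_union_downsets[OF \<alpha>] \<psi>] entails_D_alg_iff[OF \<alpha> \<psi>g]
    by (rule bex_cong[OF HOL.refl])
qed

text \<open>
  Left adjoints are unique up to isomorphism; it suffices to apply both adjunctions to the identity
  entailment on \<open>E' \<alpha>\<close>.
\<close>

lemma is_exists_along_entails:
  assumes E: "is_exists_along (D_alg P) X Y g E" and E': "is_exists_along (D_alg P) X Y g E'"
    and \<alpha>: "\<alpha> \<in> X \<rightarrow> downsets P"
  shows "entails (D_alg P) Y (E \<alpha>) (E' \<alpha>)"
proof -
  have D: "E' \<alpha> \<in> Y \<rightarrow> downsets P"
    using E' \<alpha> unfolding is_exists_along_def D_alg_simps by blast
  have "entails (D_alg P) Y (E' \<alpha>) (E' \<alpha>)" by (rule entails_D_alg_refl[OF D])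
  then have "entails (D_alg P) X \<alpha> (E' \<alpha> \<circ> g)"
    using E' \<alpha> D unfolding is_exists_along_def D_alg_simps by blast
  then show ?thesis using E \<alpha> D unfolding is_exists_along_def D_alg_simps by blast
qed

section \<open>Realizers for partial applicative morphisms\<close>

lemma D_pca_app_Some_downset:
  assumes \<delta>: "\<tau> \<bullet>\<^bsub>D_pca P\<^esub> \<alpha> = Some \<delta>" and D: "\<alpha> \<in> downsets P" "\<tau> \<in> downsets P"
  shows "\<delta> \<in> downsets P"
proof -
  from \<delta> have def': "\<forall>x \<in> \<tau>. \<forall>y \<in> \<alpha>. x \<bullet> y \<noteq> None"
    and \<delta>: "\<delta> = {z \<in> carrier P. \<exists>x \<in> \<tau>. \<exists>y \<in> \<alpha>. z \<sqsubseteq> the (x \<bullet> y)}"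
    by (auto simp: D_pca_def split: if_splits)
  have "the (x \<bullet> y) \<in> carrier P" if xy: "x \<in> \<tau>" "y \<in> \<alpha>" for x y
  proof -
    obtain v where v: "x \<bullet> y = Some v" using xy def' by blast
    have "x \<in> carrier P" "y \<in> carrier P" using xy D[THEN downsets_subset] by auto
    then show ?thesis using app_closed[OF _ _ v] v by simp
  qed
  then have "(\<Union>x \<in> \<tau>. \<Union>y \<in> \<alpha>. principal P (the (x \<bullet> y))) \<in> downsets P"
    by (auto intro!: Union_downsets principal_downset)
  moreover have "\<delta> = (\<Union>x \<in> \<tau>. \<Union>y \<in> \<alpha>. principal P (the (x \<bullet> y)))"
    by (auto simp: \<delta> kleisli_id_def)
  ultimately show "\<delta> \<in> downsets P" by simp
qed

text \<open>
  Application of downsets, where defined, is left adjoint to the arrow: \<open>\<tau> \<cdot> \<alpha> \<subseteq> \<gamma>\<close> iff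
  \<open>\<tau> \<subseteq> \<alpha> \<leadsto> \<gamma>\<close>. The definedness condition is absorbed, as an element of an arrow is defined on its
  whole domain.
\<close>

lemma D_pca_app_iff:
  assumes D: "\<tau> \<in> downsets P" "\<alpha> \<in> downsets P" "\<gamma> \<in> downsets P"
  shows "defined_le (D_pca P) (\<tau> \<bullet>\<^bsub>D_pca P\<^esub> \<alpha>) \<gamma> \<longleftrightarrow> \<tau> \<subseteq> \<alpha> \<leadsto>\<^bsub>D_alg P\<^esub> \<gamma>"
proof
  assume "defined_le (D_pca P) (\<tau> \<bullet>\<^bsub>D_pca P\<^esub> \<alpha>) \<gamma>"
  then have def': "\<forall>x \<in> \<tau>. \<forall>y \<in> \<alpha>. x \<bullet> y \<noteq> None"
    and \<gamma>: "{z \<in> carrier P. \<exists>x \<in> \<tau>. \<exists>y \<in> \<alpha>. z \<sqsubseteq> the (x \<bullet> y)} \<subseteq> \<gamma>"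
    by (auto simp: D_pca_def defined_le_def split: if_splits)
  show "\<tau> \<subseteq> \<alpha> \<leadsto>\<^bsub>D_alg P\<^esub> \<gamma>"
  proof
    fix t assume t: "t \<in> \<tau>"
    have "t \<bullet> x \<in> Some ` \<gamma>" if x: "x \<in> \<alpha>" for x
    proof -
      obtain v where v: "t \<bullet> x = Some v" using def' t x by blast
      have "t \<in> carrier P" "x \<in> carrier P" using t x D(1,2)[THEN downsets_subset] by blast+
      from app_closed[OF this v] have "v \<in> carrier P" "v \<sqsubseteq> the (t \<bullet> x)" using v by simp_all
      then have "v \<in> \<gamma>" using \<gamma> t x by blast
      then show ?thesis using v by simp
    qed
    then show "t \<in> \<alpha> \<leadsto>\<^bsub>D_alg P\<^esub> \<gamma>" using t D(1)[THEN downsets_subset] by (auto simp: mem_arr_D_alg)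
  qed
next
  assume sub: "\<tau> \<subseteq> \<alpha> \<leadsto>\<^bsub>D_alg P\<^esub> \<gamma>"
  have app: "\<exists>v \<in> \<gamma>. x \<bullet> y = Some v" if "x \<in> \<tau>" "y \<in> \<alpha>" for x y
    by (rule arr_D_algE[OF subsetD[OF sub that(1)] that(2)]) auto
  have "\<forall>x \<in> \<tau>. \<forall>y \<in> \<alpha>. x \<bullet> y \<noteq> None" using app by fastforce
  moreover have "{z \<in> carrier P. \<exists>x \<in> \<tau>. \<exists>y \<in> \<alpha>. z \<sqsubseteq> the (x \<bullet> y)} \<subseteq> \<gamma>"
  proof clarify
    fix z x y assume z: "z \<in> carrier P" "z \<sqsubseteq> the (x \<bullet> y)" and "x \<in> \<tau>" "y \<in> \<alpha>"
    then obtain v where "v \<in> \<gamma>" "x \<bullet> y = Some v" using app by blast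
    then show "z \<in> \<gamma>" using downsetsD[OF D(3), of v z] z by simp
  qed
  ultimately show "defined_le (D_pca P) (\<tau> \<bullet>\<^bsub>D_pca P\<^esub> \<alpha>) \<gamma>"
    by (simp add: D_pca_def defined_le_def)
qed

lemma D_pca_app2_iff:
  assumes D: "\<tau> \<in> downsets P" "\<alpha> \<in> downsets P" "\<beta> \<in> downsets P" "\<gamma> \<in> downsets P"
  shows "defined_le (D_pca P) (Some \<tau> \<odot>\<^bsub>D_pca P\<^esub> Some \<alpha> \<odot>\<^bsub>D_pca P\<^esub> Some \<beta>) \<gamma>
    \<longleftrightarrow> \<tau> \<subseteq> \<alpha> \<leadsto>\<^bsub>D_alg P\<^esub> \<beta> \<leadsto>\<^bsub>D_alg P\<^esub> \<gamma>"
proof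
  assume "defined_le (D_pca P) (Some \<tau> \<odot>\<^bsub>D_pca P\<^esub> Some \<alpha> \<odot>\<^bsub>D_pca P\<^esub> Some \<beta>) \<gamma>"
  then obtain \<delta> where \<delta>: "\<tau> \<bullet>\<^bsub>D_pca P\<^esub> \<alpha> = Some \<delta>" "defined_le (D_pca P) (\<delta> \<bullet>\<^bsub>D_pca P\<^esub> \<beta>) \<gamma>"
    by (cases "\<tau> \<bullet>\<^bsub>D_pca P\<^esub> \<alpha>") (auto simp: papp_def defined_le_def)
  have \<delta>D: "\<delta> \<in> downsets P" using D_pca_app_Some_downset[OF \<delta>(1)] D by blast
  have "\<tau> \<subseteq> \<alpha> \<leadsto>\<^bsub>D_alg P\<^esub> \<delta>"
    using D_pca_app_iff[OF D(1,2) \<delta>D] \<delta>(1) by (simp add: defined_le_def)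
  also have "\<dots> \<subseteq> \<alpha> \<leadsto>\<^bsub>D_alg P\<^esub> \<beta> \<leadsto>\<^bsub>D_alg P\<^esub> \<gamma>"
    using D_pca_app_iff[OF \<delta>D D(3,4)] \<delta>(2) by (intro arr_D_alg_mono) auto
  finally show "\<tau> \<subseteq> \<alpha> \<leadsto>\<^bsub>D_alg P\<^esub> \<beta> \<leadsto>\<^bsub>D_alg P\<^esub> \<gamma>" .
next
  assume "\<tau> \<subseteq> \<alpha> \<leadsto>\<^bsub>D_alg P\<^esub> \<beta> \<leadsto>\<^bsub>D_alg P\<^esub> \<gamma>"
  then obtain \<delta> where \<delta>: "\<tau> \<bullet>\<^bsub>D_pca P\<^esub> \<alpha> = Some \<delta>" "\<delta> \<subseteq> \<beta> \<leadsto>\<^bsub>D_alg P\<^esub> \<gamma>"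
    using D_pca_app_iff[OF D(1,2) arr_downset[OF D(3,4)]] by (auto simp: defined_le_def)
  then show "defined_le (D_pca P) (Some \<tau> \<odot>\<^bsub>D_pca P\<^esub> Some \<alpha> \<odot>\<^bsub>D_pca P\<^esub> Some \<beta>) \<gamma>"
    using D_pca_app_iff[OF D_pca_app_Some_downset[OF \<delta>(1) D(2,1)] D(3,4)] by simp
qed

text \<open>
  Replaces a downset of realizers by a single one: an element of the filter in one direction, its
  principal downset in the other.
\<close>

lemma D_filter_subset_iff:
  assumes "X \<subseteq> downsets P"
  shows "(\<exists>\<tau> \<in> D_filter P. \<forall>\<xi> \<in> X. \<tau> \<subseteq> \<xi>) \<longleftrightarrow> (\<exists>t \<in> filt P. \<forall>\<xi> \<in> X. t \<in> \<xi>)"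
proof
  assume "\<exists>\<tau> \<in> D_filter P. \<forall>\<xi> \<in> X. \<tau> \<subseteq> \<xi>"
  then show "\<exists>t \<in> filt P. \<forall>\<xi> \<in> X. t \<in> \<xi>" unfolding D_filter_def by blast
next
  assume "\<exists>t \<in> filt P. \<forall>\<xi> \<in> X. t \<in> \<xi>"
  then obtain t where t: "t \<in> filt P" "\<forall>\<xi> \<in> X. t \<in> \<xi>" by blast
  have "principal P t \<subseteq> \<xi>" if "\<xi> \<in> X" for \<xi>
    using principal_subset_iff[of \<xi> t] t that assms filt_subset by blast
  then show "\<exists>\<tau> \<in> D_filter P. \<forall>\<xi> \<in> X. \<tau> \<subseteq> \<xi>" using principal_D_filter[OF t(1)] by blast
qed

end

locale pca_pair = A: pca A + B: pca B
  for A :: "('a, 'l) pca_structure_scheme" and B :: "('b, 'm) pca_structure_scheme"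
begin

text \<open>
  For a map into downsets the axioms of a morphism into \<open>D_pca B\<close> ask for downsets \<open>\<tau>\<close> meeting the
  filter. The adjunction between application and arrow moves \<open>f a\<close> and \<open>f a'\<close> to the right, after
  which \<open>\<tau>\<close> can be replaced by one of its elements in the filter.
\<close>

lemma OPCA_D_iff:
  "f \<in> OPCA_D A B \<longleftrightarrow> f \<in> carrier A \<rightarrow> downsets B \<and> (\<forall>a \<in> filt A. f a \<in> D_filter B)
    \<and> (\<exists>t \<in> filt B. \<forall>a \<in> carrier A. \<forall>a' \<in> carrier A. \<forall>c. a \<bullet>\<^bsub>A\<^esub> a' = Some c \<longrightarrow>
         t \<in> f a \<leadsto>\<^bsub>D_alg B\<^esub> f a' \<leadsto>\<^bsub>D_alg B\<^esub> f c)
    \<and> (\<exists>u \<in> filt B. \<forall>a \<in> carrier A. \<forall>a' \<in> carrier A. a \<sqsubseteq>\<^bsub>A\<^esub> a' \<longrightarrow> u \<in> f a \<leadsto>\<^bsub>D_alg B\<^esub> f a')"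
proof (cases "f \<in> carrier A \<rightarrow> downsets B")
  case f: True
  let ?X = "{f a \<leadsto>\<^bsub>D_alg B\<^esub> f a' \<leadsto>\<^bsub>D_alg B\<^esub> f c | a a' c. a \<in> carrier A \<and> a' \<in> carrier A \<and> a \<bullet>\<^bsub>A\<^esub> a' = Some c}"
  let ?Y = "{f a \<leadsto>\<^bsub>D_alg B\<^esub> f a' | a a'. a \<in> carrier A \<and> a' \<in> carrier A \<and> a \<sqsubseteq>\<^bsub>A\<^esub> a'}"
  have fD: "f a \<in> downsets B" if "a \<in> carrier A" for a using f that by auto
  have fc: "f c \<in> downsets B" if "a \<in> carrier A" "a' \<in> carrier A" "a \<bullet>\<^bsub>A\<^esub> a' = Some c" for a a' c
    using A.app_closed[OF that] by (rule fD)
  have XY: "?X \<subseteq> downsets B" "?Y \<subseteq> downsets B"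
    by (auto intro!: B.arr_downset intro: fD fc)
  have D: "\<tau> \<in> downsets B" if "\<tau> \<in> D_filter B" for \<tau> using that by (simp add: D_filter_def)
  have T: "(\<exists>\<tau> \<in> D_filter B. \<forall>a \<in> carrier A. \<forall>a' \<in> carrier A. \<forall>c. a \<bullet>\<^bsub>A\<^esub> a' = Some c \<longrightarrow>
        defined_le (D_pca B) (Some \<tau> \<odot>\<^bsub>D_pca B\<^esub> Some (f a) \<odot>\<^bsub>D_pca B\<^esub> Some (f a')) (f c))
      \<longleftrightarrow> (\<exists>\<tau> \<in> D_filter B. \<forall>\<xi> \<in> ?X. \<tau> \<subseteq> \<xi>)"
  proof (rule bex_cong[OF HOL.refl])
    fix \<tau> assume \<tau>: "\<tau> \<in> D_filter B"
    have eq: "defined_le (D_pca B) (Some \<tau> \<odot>\<^bsub>D_pca B\<^esub> Some (f a) \<odot>\<^bsub>D_pca B\<^esub> Some (f a')) (f c)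
        \<longleftrightarrow> \<tau> \<subseteq> f a \<leadsto>\<^bsub>D_alg B\<^esub> f a' \<leadsto>\<^bsub>D_alg B\<^esub> f c"
      if c: "a \<in> carrier A" "a' \<in> carrier A" "a \<bullet>\<^bsub>A\<^esub> a' = Some c" for a a' c
      by (rule B.D_pca_app2_iff[OF D[OF \<tau>] fD[OF c(1)] fD[OF c(2)] fc[OF c]])
    have "(\<forall>\<xi> \<in> ?X. \<tau> \<subseteq> \<xi>) \<longleftrightarrow> (\<forall>a \<in> carrier A. \<forall>a' \<in> carrier A. \<forall>c. a \<bullet>\<^bsub>A\<^esub> a' = Some c \<longrightarrow>
        \<tau> \<subseteq> f a \<leadsto>\<^bsub>D_alg B\<^esub> f a' \<leadsto>\<^bsub>D_alg B\<^esub> f c)" by blast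
    then show "(\<forall>a \<in> carrier A. \<forall>a' \<in> carrier A. \<forall>c. a \<bullet>\<^bsub>A\<^esub> a' = Some c \<longrightarrow>
        defined_le (D_pca B) (Some \<tau> \<odot>\<^bsub>D_pca B\<^esub> Some (f a) \<odot>\<^bsub>D_pca B\<^esub> Some (f a')) (f c))
      \<longleftrightarrow> (\<forall>\<xi> \<in> ?X. \<tau> \<subseteq> \<xi>)" by (simp only: eq cong: ball_cong imp_cong)
  qed
  have U: "(\<exists>\<tau> \<in> D_filter B. \<forall>a \<in> carrier A. \<forall>a' \<in> carrier A. a \<sqsubseteq>\<^bsub>A\<^esub> a' \<longrightarrow>
        defined_le (D_pca B) (\<tau> \<bullet>\<^bsub>D_pca B\<^esub> f a) (f a'))
      \<longleftrightarrow> (\<exists>\<tau> \<in> D_filter B. \<forall>\<xi> \<in> ?Y. \<tau> \<subseteq> \<xi>)"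
  proof (rule bex_cong[OF HOL.refl])
    fix \<tau> assume \<tau>: "\<tau> \<in> D_filter B"
    have eq: "defined_le (D_pca B) (\<tau> \<bullet>\<^bsub>D_pca B\<^esub> f a) (f a') \<longleftrightarrow> \<tau> \<subseteq> f a \<leadsto>\<^bsub>D_alg B\<^esub> f a'"
      if "a \<in> carrier A" "a' \<in> carrier A" for a a'
      by (rule B.D_pca_app_iff[OF D[OF \<tau>] fD[OF that(1)] fD[OF that(2)]])
    have "(\<forall>\<xi> \<in> ?Y. \<tau> \<subseteq> \<xi>) \<longleftrightarrow> (\<forall>a \<in> carrier A. \<forall>a' \<in> carrier A. a \<sqsubseteq>\<^bsub>A\<^esub> a' \<longrightarrow>
        \<tau> \<subseteq> f a \<leadsto>\<^bsub>D_alg B\<^esub> f a')" by blast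
    then show "(\<forall>a \<in> carrier A. \<forall>a' \<in> carrier A. a \<sqsubseteq>\<^bsub>A\<^esub> a' \<longrightarrow>
        defined_le (D_pca B) (\<tau> \<bullet>\<^bsub>D_pca B\<^esub> f a) (f a')) \<longleftrightarrow> (\<forall>\<xi> \<in> ?Y. \<tau> \<subseteq> \<xi>)"
      by (simp only: eq cong: ball_cong imp_cong)
  qed
  have "(\<exists>t \<in> filt B. \<forall>\<xi> \<in> ?X. t \<in> \<xi>)
      \<longleftrightarrow> (\<exists>t \<in> filt B. \<forall>a \<in> carrier A. \<forall>a' \<in> carrier A. \<forall>c. a \<bullet>\<^bsub>A\<^esub> a' = Some c \<longrightarrow>
         t \<in> f a \<leadsto>\<^bsub>D_alg B\<^esub> f a' \<leadsto>\<^bsub>D_alg B\<^esub> f c)"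
    by (rule bex_cong[OF HOL.refl]) blast
  note T' = T[unfolded B.D_filter_subset_iff[OF XY(1)] this]
  have "(\<exists>t \<in> filt B. \<forall>\<xi> \<in> ?Y. t \<in> \<xi>)
      \<longleftrightarrow> (\<exists>u \<in> filt B. \<forall>a \<in> carrier A. \<forall>a' \<in> carrier A. a \<sqsubseteq>\<^bsub>A\<^esub> a' \<longrightarrow> u \<in> f a \<leadsto>\<^bsub>D_alg B\<^esub> f a')"
    by (rule bex_cong[OF HOL.refl]) blast
  note U' = U[unfolded B.D_filter_subset_iff[OF XY(2)] this]
  show ?thesis unfolding OPCA_D_def OPCA_def D_pca_simps mem_Collect_eq T' U' ..
qed (simp add: OPCA_D_def OPCA_def)

lemma OPCA_D_le_iff:
  assumes "f \<in> carrier A \<rightarrow> downsets B" "f' \<in> carrier A \<rightarrow> downsets B"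
  shows "OPCA_D_le A B f f' \<longleftrightarrow> (\<exists>s \<in> filt B. \<forall>a \<in> carrier A. s \<in> f a \<leadsto>\<^bsub>D_alg B\<^esub> f' a)"
proof -
  have fD: "f a \<in> downsets B" "f' a \<in> downsets B" if "a \<in> carrier A" for a using assms that by auto
  have X: "{f a \<leadsto>\<^bsub>D_alg B\<^esub> f' a | a. a \<in> carrier A} \<subseteq> downsets B" (is "?X \<subseteq> _")
    using fD by (auto intro!: B.arr_downset)
  have "OPCA_D_le A B f f' \<longleftrightarrow> (\<exists>\<tau> \<in> D_filter B. \<forall>\<xi> \<in> ?X. \<tau> \<subseteq> \<xi>)"
    unfolding OPCA_D_le_def OPCA_le_def D_pca_simps
    by (intro bex_cong HOL.refl) (auto simp: B.D_pca_app_iff fD D_filter_def)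
  then show ?thesis unfolding B.D_filter_subset_iff[OF X] by blast
qed

lemma ArrAlg_D_alg_iff:
  "g \<in> ArrAlg (D_alg A) (D_alg B) \<longleftrightarrow> g \<in> downsets A \<rightarrow> downsets B \<and> (\<forall>\<alpha> \<in> D_filter A. g \<alpha> \<in> D_filter B)
    \<and> (\<exists>r \<in> filt B. \<forall>\<alpha> \<in> downsets A. \<forall>\<beta> \<in> downsets A.
         r \<in> g (\<alpha> \<leadsto>\<^bsub>D_alg A\<^esub> \<beta>) \<leadsto>\<^bsub>D_alg B\<^esub> g \<alpha> \<leadsto>\<^bsub>D_alg B\<^esub> g \<beta>)
    \<and> (\<forall>R \<subseteq> downsets A \<times> downsets A. (\<exists>e \<in> filt A. \<forall>(\<alpha>, \<beta>) \<in> R. e \<in> \<alpha> \<leadsto>\<^bsub>D_alg A\<^esub> \<beta>) \<longrightarrow>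
         (\<exists>e \<in> filt B. \<forall>(\<alpha>, \<beta>) \<in> R. e \<in> g \<alpha> \<leadsto>\<^bsub>D_alg B\<^esub> g \<beta>))"
proof (cases "g \<in> downsets A \<rightarrow> downsets B")
  case g: True
  then have gD: "g \<alpha> \<in> downsets B" if "\<alpha> \<in> downsets A" for \<alpha> using that by auto
  let ?X = "{g (\<alpha> \<leadsto>\<^bsub>D_alg A\<^esub> \<beta>) \<leadsto>\<^bsub>D_alg B\<^esub> g \<alpha> \<leadsto>\<^bsub>D_alg B\<^esub> g \<beta> | \<alpha> \<beta>. \<alpha> \<in> downsets A \<and> \<beta> \<in> downsets A}"
  have X: "?X \<subseteq> downsets B" using gD by (auto intro!: B.arr_downset A.arr_downset)
  have r: "(\<exists>\<tau> \<in> D_filter B. \<forall>\<alpha> \<in> downsets A. \<forall>\<beta> \<in> downsets A.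
         \<tau> \<subseteq> g (\<alpha> \<leadsto>\<^bsub>D_alg A\<^esub> \<beta>) \<leadsto>\<^bsub>D_alg B\<^esub> g \<alpha> \<leadsto>\<^bsub>D_alg B\<^esub> g \<beta>)
      \<longleftrightarrow> (\<exists>r \<in> filt B. \<forall>\<alpha> \<in> downsets A. \<forall>\<beta> \<in> downsets A.
         r \<in> g (\<alpha> \<leadsto>\<^bsub>D_alg A\<^esub> \<beta>) \<leadsto>\<^bsub>D_alg B\<^esub> g \<alpha> \<leadsto>\<^bsub>D_alg B\<^esub> g \<beta>)" (is "?l \<longleftrightarrow> ?r")
  proof -
    have "?l \<longleftrightarrow> (\<exists>\<tau> \<in> D_filter B. \<forall>\<xi> \<in> ?X. \<tau> \<subseteq> \<xi>)" by (intro bex_cong HOL.refl) blast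
    also have "\<dots> \<longleftrightarrow> ?r" unfolding B.D_filter_subset_iff[OF X] by (intro bex_cong HOL.refl) blast
    finally show ?thesis .
  qed
  have R: "\<Sqinter>\<^bsub>D_alg A\<^esub> {\<alpha> \<leadsto>\<^bsub>D_alg A\<^esub> \<beta> | \<alpha> \<beta>. (\<alpha>, \<beta>) \<in> R} \<in> D_filter A
        \<longleftrightarrow> (\<exists>e \<in> filt A. \<forall>(\<alpha>, \<beta>) \<in> R. e \<in> \<alpha> \<leadsto>\<^bsub>D_alg A\<^esub> \<beta>)"
      "\<Sqinter>\<^bsub>D_alg B\<^esub> {g \<alpha> \<leadsto>\<^bsub>D_alg B\<^esub> g \<beta> | \<alpha> \<beta>. (\<alpha>, \<beta>) \<in> R} \<in> D_filter B
        \<longleftrightarrow> (\<exists>e \<in> filt B. \<forall>(\<alpha>, \<beta>) \<in> R. e \<in> g \<alpha> \<leadsto>\<^bsub>D_alg B\<^esub> g \<beta>)"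
    if "R \<subseteq> downsets A \<times> downsets A" for R
  proof -
    have "{\<alpha> \<leadsto>\<^bsub>D_alg A\<^esub> \<beta> | \<alpha> \<beta>. (\<alpha>, \<beta>) \<in> R} \<subseteq> downsets A"
      "{g \<alpha> \<leadsto>\<^bsub>D_alg B\<^esub> g \<beta> | \<alpha> \<beta>. (\<alpha>, \<beta>) \<in> R} \<subseteq> downsets B"
      using that gD by (auto intro!: B.arr_downset A.arr_downset)
    note * = A.Inf_D_alg_separator_iff[OF this(1)] B.Inf_D_alg_separator_iff[OF this(2)]
    show "\<Sqinter>\<^bsub>D_alg A\<^esub> {\<alpha> \<leadsto>\<^bsub>D_alg A\<^esub> \<beta> | \<alpha> \<beta>. (\<alpha>, \<beta>) \<in> R} \<in> D_filter A
        \<longleftrightarrow> (\<exists>e \<in> filt A. \<forall>(\<alpha>, \<beta>) \<in> R. e \<in> \<alpha> \<leadsto>\<^bsub>D_alg A\<^esub> \<beta>)"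
      "\<Sqinter>\<^bsub>D_alg B\<^esub> {g \<alpha> \<leadsto>\<^bsub>D_alg B\<^esub> g \<beta> | \<alpha> \<beta>. (\<alpha>, \<beta>) \<in> R} \<in> D_filter B
        \<longleftrightarrow> (\<exists>e \<in> filt B. \<forall>(\<alpha>, \<beta>) \<in> R. e \<in> g \<alpha> \<leadsto>\<^bsub>D_alg B\<^esub> g \<beta>)"
      unfolding * by (intro bex_cong HOL.refl; blast)+
  qed
  show ?thesis using g R
    unfolding ArrAlg_def implicative_morphism_def D_alg_simps mem_Collect_eq r by simp
qed (simp add: ArrAlg_def implicative_morphism_def)

end

section \<open>Regularity and unions\<close>

lemma D_tilde_Union: "D_tilde f (\<Union>\<S>) = \<Union> (D_tilde f ` \<S>)"
  by (auto simp: D_tilde_def)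

text \<open>
  The inverse of \<open>D_tilde\<close> on hom-preorders.
\<close>

definition along_principal :: "('a, 'm) pca_structure_scheme \<Rightarrow> ('a set \<Rightarrow> 'b) \<Rightarrow> 'a \<Rightarrow> 'b" where
  "along_principal P g a = g (principal P a)"

context pca_pair begin

text \<open>
  Condition (iii) on implicative morphisms, applied to the set of pairs \<open>(\<phi> i, \<psi> i)\<close>.
\<close>

lemma ArrAlg_entails_map:
  assumes g: "g \<in> ArrAlg (D_alg A) (D_alg B)" and "entails (D_alg A) I \<phi> \<psi>"
    and D: "\<phi> \<in> I \<rightarrow> downsets A" "\<psi> \<in> I \<rightarrow> downsets A"
  shows "entails (D_alg B) I (g \<circ> \<phi>) (g \<circ> \<psi>)"
proof -
  let ?R = "(\<lambda>i. (\<phi> i, \<psi> i)) ` I"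
  have gD: "g \<in> downsets A \<rightarrow> downsets B" using g unfolding ArrAlg_D_alg_iff by blast
  have "?R \<subseteq> downsets A \<times> downsets A" using D by auto
  moreover have "\<exists>e \<in> filt A. \<forall>(\<alpha>, \<beta>) \<in> ?R. e \<in> \<alpha> \<leadsto>\<^bsub>D_alg A\<^esub> \<beta>"
    using assms(2) unfolding A.entails_D_alg_iff[OF D] by simp
  ultimately have "\<exists>e \<in> filt B. \<forall>(\<alpha>, \<beta>) \<in> ?R. e \<in> g \<alpha> \<leadsto>\<^bsub>D_alg B\<^esub> g \<beta>"
    using g unfolding ArrAlg_D_alg_iff by blast
  moreover have "g \<circ> \<phi> \<in> I \<rightarrow> downsets B" "g \<circ> \<psi> \<in> I \<rightarrow> downsets B"
    using gD D by (auto simp: Pi_iff)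
  ultimately show ?thesis by (simp add: B.entails_D_alg_iff)
qed

text \<open>
  Any left adjoint is isomorphic to the one given by unions over fibres, with which \<open>g\<close> commutes.
  Postcomposition with \<open>g\<close> preserves the isomorphism in the source because it preserves
  entailment.
\<close>

lemma regular_over_if_preserves_Union:
  assumes g: "g \<in> ArrAlg (D_alg A) (D_alg B)"
    and Un: "\<And>\<S>. \<S> \<subseteq> downsets A \<Longrightarrow> g (\<Union>\<S>) = \<Union> (g ` \<S>)"
  shows "regular_over TYPE('i) TYPE('j) (D_alg A) (D_alg B) g"
  unfolding regular_over_def D_alg_simps
proof (intro allI impI ballI)
  fix X :: "'i set" and Y :: "'j set" and h EA EB and \<alpha> :: "'i \<Rightarrow> 'a set"
  assume h: "h \<in> X \<rightarrow> Y" and EA: "is_exists_along (D_alg A) X Y h EA"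
    and EB: "is_exists_along (D_alg B) X Y h EB" and \<alpha>: "\<alpha> \<in> X \<rightarrow> downsets A"
  have gD: "g \<in> downsets A \<rightarrow> downsets B" using g unfolding ArrAlg_D_alg_iff by blast
  have g\<alpha>: "g \<circ> \<alpha> \<in> X \<rightarrow> downsets B" using gD \<alpha> by (auto simp: Pi_iff)
  note UA = A.is_exists_along_fibre_union[OF h] and UB = B.is_exists_along_fibre_union[OF h]
  have U: "fibre_union X h (g \<circ> \<alpha>) = g \<circ> fibre_union X h \<alpha>"
  proof
    fix y
    have "\<alpha> ` {x \<in> X. h x = y} \<subseteq> downsets A" using \<alpha> by auto
    from Un[OF this] show "fibre_union X h (g \<circ> \<alpha>) y = (g \<circ> fibre_union X h \<alpha>) y"
      by (simp add: fibre_union_def image_comp)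
  qed
  have D: "EA \<alpha> \<in> Y \<rightarrow> downsets A" "fibre_union X h \<alpha> \<in> Y \<rightarrow> downsets A"
      "EB (g \<circ> \<alpha>) \<in> Y \<rightarrow> downsets B"
    using EA EB \<alpha> g\<alpha> unfolding is_exists_along_def D_alg_simps
    by (blast, intro A.fibre_union_downsets \<alpha>, blast)
  have gDs: "g \<circ> EA \<alpha> \<in> Y \<rightarrow> downsets B" "g \<circ> fibre_union X h \<alpha> \<in> Y \<rightarrow> downsets B"
    using gD D by (auto simp: Pi_iff)
  show "iso_entails (D_alg B) Y (g \<circ> EA \<alpha>) (EB (g \<circ> \<alpha>))"
    unfolding iso_entails_def
  proof
    have "entails (D_alg B) Y (g \<circ> EA \<alpha>) (g \<circ> fibre_union X h \<alpha>)"
      by (rule ArrAlg_entails_map[OF g A.is_exists_along_entails[OF EA UA \<alpha>] D(1,2)])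
    moreover have "entails (D_alg B) Y (g \<circ> fibre_union X h \<alpha>) (EB (g \<circ> \<alpha>))"
      using B.is_exists_along_entails[OF UB EB g\<alpha>] unfolding U .
    ultimately show "entails (D_alg B) Y (g \<circ> EA \<alpha>) (EB (g \<circ> \<alpha>))"
      by (rule B.entails_D_alg_trans) (fact gDs D)+
    have "entails (D_alg B) Y (EB (g \<circ> \<alpha>)) (g \<circ> fibre_union X h \<alpha>)"
      using B.is_exists_along_entails[OF EB UB g\<alpha>] unfolding U .
    moreover have "entails (D_alg B) Y (g \<circ> fibre_union X h \<alpha>) (g \<circ> EA \<alpha>)"
      by (rule ArrAlg_entails_map[OF g A.is_exists_along_entails[OF UA EA \<alpha>] D(2,1)])
    ultimately show "entails (D_alg B) Y (EB (g \<circ> \<alpha>)) (g \<circ> EA \<alpha>)"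
      by (rule B.entails_D_alg_trans) (fact gDs D)+
  qed
qed

text \<open>
  The generic family of downsets is \<open>snd\<close> on the membership relation \<open>X\<close>, and \<open>fst\<close> projects it
  to the set \<open>Y\<close> of all families. Quantifying it along \<open>fst\<close> yields \<open>\<S> \<mapsto> \<Union>\<S>\<close>, so the
  realizers provided by regularity are uniform over all \<open>\<S> \<in> Y\<close>.
\<close>

lemma regular_Union_realizers:
  assumes g: "g \<in> ArrAlg_reg (D_alg A) (D_alg B)"
  shows "\<exists>e \<in> filt B. \<forall>\<S> \<subseteq> downsets A. e \<in> g (\<Union>\<S>) \<leadsto>\<^bsub>D_alg B\<^esub> \<Union> (g ` \<S>)"
    and "\<exists>e \<in> filt B. \<forall>\<S> \<subseteq> downsets A. e \<in> \<Union> (g ` \<S>) \<leadsto>\<^bsub>D_alg B\<^esub> g (\<Union>\<S>)"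
proof -
  have gD: "g \<in> downsets A \<rightarrow> downsets B" and reg: "regular (D_alg A) (D_alg B) g"
    using g unfolding ArrAlg_reg_def ArrAlg_D_alg_iff by auto
  define Y where "Y = Pow (downsets A)"
  define X where "X = {(\<S>, \<alpha>). \<S> \<in> Y \<and> \<alpha> \<in> \<S>}"
  have fst: "fst \<in> X \<rightarrow> Y" and snd: "snd \<in> X \<rightarrow> downsets A" by (auto simp: X_def Y_def)
  have gsnd: "g \<circ> snd \<in> X \<rightarrow> downsets B" using gD snd by (auto simp: Pi_iff)
  have iso: "iso_entails (D_alg B) Y (g \<circ> fibre_union X fst snd) (fibre_union X fst (g \<circ> snd))"
    using reg[unfolded regular_def regular_over_def D_alg_simps, rule_format, OF fst
        A.is_exists_along_fibre_union[OF fst] B.is_exists_along_fibre_union[OF fst] snd] .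
  have "{x \<in> X. fst x = \<S>} = Pair \<S> ` \<S>" if "\<S> \<in> Y" for \<S>
    using that by (auto simp: X_def)
  then have U: "fibre_union X fst snd \<S> = \<Union>\<S>" "fibre_union X fst (g \<circ> snd) \<S> = \<Union> (g ` \<S>)"
    if "\<S> \<in> Y" for \<S>
    using that by (simp_all add: fibre_union_def image_image)
  have D: "g \<circ> fibre_union X fst snd \<in> Y \<rightarrow> downsets B"
      "fibre_union X fst (g \<circ> snd) \<in> Y \<rightarrow> downsets B"
    using A.fibre_union_downsets[OF snd, of fst Y] gD B.fibre_union_downsets[OF gsnd, of fst Y]
    by (simp_all add: Pi_iff)
  show "\<exists>e \<in> filt B. \<forall>\<S> \<subseteq> downsets A. e \<in> g (\<Union>\<S>) \<leadsto>\<^bsub>D_alg B\<^esub> \<Union> (g ` \<S>)"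
    "\<exists>e \<in> filt B. \<forall>\<S> \<subseteq> downsets A. e \<in> \<Union> (g ` \<S>) \<leadsto>\<^bsub>D_alg B\<^esub> g (\<Union>\<S>)"
    using iso unfolding iso_entails_def B.entails_D_alg_iff[OF D] B.entails_D_alg_iff[OF D(2,1)]
    by (simp_all add: U) (simp_all add: Y_def Ball_def)
qed

section \<open>The functor on hom-preorders\<close>

lemma D_tilde_downsets: "f \<in> carrier A \<rightarrow> downsets B \<Longrightarrow> D_tilde f \<in> downsets A \<rightarrow> downsets B"
proof
  fix \<alpha> assume f: "f \<in> carrier A \<rightarrow> downsets B" and "\<alpha> \<in> downsets A"
  then have "f ` \<alpha> \<subseteq> downsets B" using downsets_subset[of \<alpha> A] by auto
  then show "D_tilde f \<alpha> \<in> downsets B" unfolding D_tilde_def by (rule Union_downsets)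
qed

text \<open>
  If \<open>x \<in> f a\<close> with \<open>a \<in> \<alpha> \<leadsto> \<beta>\<close> and \<open>y \<in> f b\<close> with \<open>b \<in> \<alpha>\<close>, then \<open>c = a b\<close> is defined and lies in \<open>\<beta>\<close>, and
  the tracker \<open>t\<close> of \<open>f\<close> gives \<open>t x y \<in> f c\<close>. Condition (ii) follows, with \<open>t\<close> in expanded form. For
  condition (iii), a realizer \<open>e\<close> of all arrows in \<open>R\<close> has some \<open>x \<in> f e\<close> in the filter, and then
  the element \<open>r x\<close> realizes all image arrows.
\<close>

lemma D_tilde_ArrAlg:
  assumes "f \<in> OPCA_D A B"
  shows "D_tilde f \<in> ArrAlg (D_alg A) (D_alg B)"
proof -
  have f: "f \<in> carrier A \<rightarrow> downsets B" and filt: "\<forall>a \<in> filt A. f a \<in> D_filter B"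
    using assms unfolding OPCA_D_iff by blast+
  obtain t where "t \<in> filt B" and t: "\<And>a a' c. \<lbrakk>a \<in> carrier A; a' \<in> carrier A; a \<bullet>\<^bsub>A\<^esub> a' = Some c\<rbrakk>
      \<Longrightarrow> t \<in> f a \<leadsto>\<^bsub>D_alg B\<^esub> f a' \<leadsto>\<^bsub>D_alg B\<^esub> f c"
    using assms unfolding OPCA_D_iff by blast
  note D = funcset_mem[OF D_tilde_downsets[OF f]]
  obtain r where "r \<in> filt B" and r: "\<forall>\<alpha> \<in> downsets B. \<forall>\<beta> \<in> downsets B. \<forall>\<gamma> \<in> downsets B.
    (\<forall>x \<in> \<alpha>. \<forall>y \<in> \<beta>. t \<bullet>\<^bsub>B\<^esub> x \<odot>\<^bsub>B\<^esub> Some y \<in> Some ` \<gamma>) \<longrightarrow> r \<in> \<alpha> \<leadsto>\<^bsub>D_alg B\<^esub> \<beta> \<leadsto>\<^bsub>D_alg B\<^esub> \<gamma>"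
    using B.ex_curried_realizer[OF \<open>t \<in> filt B\<close>] by blast
  have r: "r \<in> D_tilde f (\<alpha> \<leadsto>\<^bsub>D_alg A\<^esub> \<beta>) \<leadsto>\<^bsub>D_alg B\<^esub> D_tilde f \<alpha> \<leadsto>\<^bsub>D_alg B\<^esub> D_tilde f \<beta>"
    if \<alpha>\<beta>: "\<alpha> \<in> downsets A" "\<beta> \<in> downsets A" for \<alpha> \<beta>
  proof (rule r[rule_format, OF D[OF A.arr_downset[OF \<alpha>\<beta>]] D[OF \<alpha>\<beta>(1)] D[OF \<alpha>\<beta>(2)]])
    fix x y assume "x \<in> D_tilde f (\<alpha> \<leadsto>\<^bsub>D_alg A\<^esub> \<beta>)" "y \<in> D_tilde f \<alpha>"
    then obtain a b where a: "a \<in> \<alpha> \<leadsto>\<^bsub>D_alg A\<^esub> \<beta>" "x \<in> f a" and b: "b \<in> \<alpha>" "y \<in> f b"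
      by (auto simp: D_tilde_def)
    obtain c where c: "a \<bullet>\<^bsub>A\<^esub> b = Some c" "c \<in> \<beta>" by (rule arr_D_algE[OF a(1) b(1)])
    have "t \<in> f a \<leadsto>\<^bsub>D_alg B\<^esub> f b \<leadsto>\<^bsub>D_alg B\<^esub> f c"
      by (rule t[OF arr_D_alg_carrier[OF a(1)] subsetD[OF downsets_subset[OF \<alpha>\<beta>(1)] b(1)] c(1)])
    then have "t \<bullet>\<^bsub>B\<^esub> x \<odot>\<^bsub>B\<^esub> Some y \<in> Some ` f c"
      using a b by (intro B.papp_arr[of _ "f b"]) (simp_all add: mem_arr_D_alg)
    then show "t \<bullet>\<^bsub>B\<^esub> x \<odot>\<^bsub>B\<^esub> Some y \<in> Some ` D_tilde f \<beta>" using c(2) by (auto simp: D_tilde_def)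
  qed
  have uniform: "\<exists>e \<in> filt B. \<forall>(\<alpha>, \<beta>) \<in> R. e \<in> D_tilde f \<alpha> \<leadsto>\<^bsub>D_alg B\<^esub> D_tilde f \<beta>"
    if R: "R \<subseteq> downsets A \<times> downsets A"
      and ex: "\<exists>e \<in> filt A. \<forall>(\<alpha>, \<beta>) \<in> R. e \<in> \<alpha> \<leadsto>\<^bsub>D_alg A\<^esub> \<beta>" for R
  \<comment> \<open>If \<open>R\<close> is empty, nothing shows that \<open>r x\<close> is defined, but any element of the filter will do.\<close>
  proof (cases "R = {}")
    case False
    then obtain \<alpha>\<^sub>0 \<beta>\<^sub>0 where R0: "(\<alpha>\<^sub>0, \<beta>\<^sub>0) \<in> R" by auto
    obtain e where e: "e \<in> filt A" "\<And>\<alpha> \<beta>. (\<alpha>, \<beta>) \<in> R \<Longrightarrow> e \<in> \<alpha> \<leadsto>\<^bsub>D_alg A\<^esub> \<beta>" using ex by blast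
    obtain x where x: "x \<in> f e" "x \<in> filt B" using filt e(1) unfolding D_filter_def by blast
    have rx: "r \<bullet>\<^bsub>B\<^esub> x \<in> Some ` (D_tilde f \<alpha> \<leadsto>\<^bsub>D_alg B\<^esub> D_tilde f \<beta>)" if "(\<alpha>, \<beta>) \<in> R" for \<alpha> \<beta>
    proof -
      have "x \<in> D_tilde f (\<alpha> \<leadsto>\<^bsub>D_alg A\<^esub> \<beta>)" using e(2)[OF that] x(1) unfolding D_tilde_def by blast
      moreover have "\<alpha> \<in> downsets A" "\<beta> \<in> downsets A" using that R by auto
      ultimately show ?thesis using r by (simp add: mem_arr_D_alg[of r])
    qed
    obtain v where v: "r \<bullet>\<^bsub>B\<^esub> x = Some v" using rx[OF R0] by blast
    have "v \<in> filt B" by (rule B.filt_app[OF \<open>r \<in> filt B\<close> x(2) v])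
    moreover have "\<forall>(\<alpha>, \<beta>) \<in> R. v \<in> D_tilde f \<alpha> \<leadsto>\<^bsub>D_alg B\<^esub> D_tilde f \<beta>"
      using rx unfolding v by (auto simp: inj_image_mem_iff)
    ultimately show ?thesis ..
  qed (use \<open>r \<in> filt B\<close> in blast)
  have "D_tilde f \<alpha> \<in> D_filter B" if "\<alpha> \<in> D_filter A" for \<alpha>
  proof -
    obtain a where a: "a \<in> \<alpha>" "a \<in> filt A" and \<alpha>: "\<alpha> \<in> downsets A"
      using \<open>\<alpha> \<in> D_filter A\<close> unfolding D_filter_def by blast
    then have "f a \<inter> filt B \<noteq> {}" "f a \<subseteq> D_tilde f \<alpha>"
      using filt unfolding D_filter_def D_tilde_def by blast+
    then show ?thesis using D[OF \<alpha>] unfolding D_filter_def by blast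
  qed
  moreover have "\<exists>r \<in> filt B. \<forall>\<alpha> \<in> downsets A. \<forall>\<beta> \<in> downsets A.
      r \<in> D_tilde f (\<alpha> \<leadsto>\<^bsub>D_alg A\<^esub> \<beta>) \<leadsto>\<^bsub>D_alg B\<^esub> D_tilde f \<alpha> \<leadsto>\<^bsub>D_alg B\<^esub> D_tilde f \<beta>"
    using \<open>r \<in> filt B\<close> r by blast
  ultimately show ?thesis
    unfolding ArrAlg_D_alg_iff using D_tilde_downsets[OF f] uniform by simp
qed

lemma D_tilde_regular_over:
  "f \<in> OPCA_D A B \<Longrightarrow> regular_over TYPE('i) TYPE('j) (D_alg A) (D_alg B) (D_tilde f)"
  by (rule regular_over_if_preserves_Union[OF D_tilde_ArrAlg D_tilde_Union])

lemma D_tilde_ArrAlg_reg: "f \<in> OPCA_D A B \<Longrightarrow> D_tilde f \<in> ArrAlg_reg (D_alg A) (D_alg B)"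
  by (simp add: ArrAlg_reg_def regular_def D_tilde_ArrAlg D_tilde_regular_over)

lemma ArrAlg_le_iff:
  assumes "g \<in> downsets A \<rightarrow> downsets B" "g' \<in> downsets A \<rightarrow> downsets B"
  shows "ArrAlg_le (D_alg A) (D_alg B) g g' \<longleftrightarrow> (\<exists>e \<in> filt B. \<forall>\<alpha> \<in> downsets A. e \<in> g \<alpha> \<leadsto>\<^bsub>D_alg B\<^esub> g' \<alpha>)"
  unfolding ArrAlg_le_def D_alg_simps by (rule B.entails_D_alg_iff[OF assms])

lemma D_tilde_mono:
  assumes f: "f \<in> carrier A \<rightarrow> downsets B" "f' \<in> carrier A \<rightarrow> downsets B" and "OPCA_D_le A B f f'"
  shows "ArrAlg_le (D_alg A) (D_alg B) (D_tilde f) (D_tilde f')"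
proof -
  obtain s where s: "s \<in> filt B" "\<forall>a \<in> carrier A. s \<in> f a \<leadsto>\<^bsub>D_alg B\<^esub> f' a"
    using assms(3) unfolding OPCA_D_le_iff[OF f] by blast
  have "s \<in> D_tilde f \<alpha> \<leadsto>\<^bsub>D_alg B\<^esub> D_tilde f' \<alpha>" if "\<alpha> \<in> downsets A" for \<alpha>
    unfolding mem_arr_D_alg
  proof (intro conjI ballI)
    show "s \<in> carrier B" using s(1) B.filt_subset by blast
    fix x assume "x \<in> D_tilde f \<alpha>"
    then obtain a where a: "a \<in> \<alpha>" "x \<in> f a" unfolding D_tilde_def by blast
    then have "s \<in> f a \<leadsto>\<^bsub>D_alg B\<^esub> f' a" using s(2) downsets_subset[OF that] by blast
    then show "s \<bullet>\<^bsub>B\<^esub> x \<in> Some ` D_tilde f' \<alpha>"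
      using a by (auto elim!: arr_D_algE simp: D_tilde_def)
  qed
  then show ?thesis
    unfolding ArrAlg_le_iff[OF D_tilde_downsets[OF f(1)] D_tilde_downsets[OF f(2)]] using s(1) by blast
qed

lemma along_principal_downsets:
  "g \<in> downsets A \<rightarrow> downsets B \<Longrightarrow> along_principal A g \<in> carrier A \<rightarrow> downsets B"
  using A.principal_downset by (auto simp: along_principal_def)

text \<open>
  Condition (iii) is applied to sets of pairs with \<open>\<alpha> \<subseteq> \<beta>\<close>, for which the identity meets its premise.
  Monotonicity comes from the pairs \<open>(principal a, principal a')\<close> with \<open>a \<sqsubseteq> a'\<close>. The tracker comes
  from the pairs \<open>(principal a, principal a' \<leadsto> principal c)\<close> with \<open>a a' = c\<close>, followed by the
  realizer \<open>r\<close> of condition (ii).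
\<close>

lemma along_principal_OPCA_D:
  assumes "g \<in> ArrAlg (D_alg A) (D_alg B)"
  shows "along_principal A g \<in> OPCA_D A B"
proof -
  let ?G = "along_principal A g"
  note g = assms[unfolded ArrAlg_D_alg_iff]
  have gD: "g \<in> downsets A \<rightarrow> downsets B" and filt: "\<forall>\<alpha> \<in> D_filter A. g \<alpha> \<in> D_filter B"
    using g by simp_all
  note uniform = g[THEN conjunct2, THEN conjunct2, THEN conjunct2, THEN spec, THEN mp, THEN mp]
  have "\<exists>r \<in> filt B. \<forall>\<alpha> \<in> downsets A. \<forall>\<beta> \<in> downsets A.
      r \<in> g (\<alpha> \<leadsto>\<^bsub>D_alg A\<^esub> \<beta>) \<leadsto>\<^bsub>D_alg B\<^esub> g \<alpha> \<leadsto>\<^bsub>D_alg B\<^esub> g \<beta>"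
    using g by simp
  then obtain r where "r \<in> filt B" and r: "\<And>\<alpha> \<beta>. \<lbrakk>\<alpha> \<in> downsets A; \<beta> \<in> downsets A\<rbrakk>
      \<Longrightarrow> r \<in> g (\<alpha> \<leadsto>\<^bsub>D_alg A\<^esub> \<beta>) \<leadsto>\<^bsub>D_alg B\<^esub> g \<alpha> \<leadsto>\<^bsub>D_alg B\<^esub> g \<beta>"
    by blast
  obtain i where "i \<in> filt A" and i: "\<And>\<alpha>. \<alpha> \<in> downsets A \<Longrightarrow> i \<in> \<alpha> \<leadsto>\<^bsub>D_alg A\<^esub> \<alpha>"
    using A.ex_identity_realizer by blast
  note pD = A.principal_downset
  have le: "\<exists>e \<in> filt B. \<forall>(\<alpha>, \<beta>) \<in> R. e \<in> g \<alpha> \<leadsto>\<^bsub>D_alg B\<^esub> g \<beta>"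
    if "R \<subseteq> downsets A \<times> downsets A" "\<And>\<alpha> \<beta>. (\<alpha>, \<beta>) \<in> R \<Longrightarrow> \<alpha> \<subseteq> \<beta>" for R
  proof (rule uniform[OF that(1)], rule bexI[OF _ \<open>i \<in> filt A\<close>], clarify)
    fix \<alpha> \<beta> assume R: "(\<alpha>, \<beta>) \<in> R"
    then have "\<alpha> \<in> downsets A" using that(1) by auto
    then show "i \<in> \<alpha> \<leadsto>\<^bsub>D_alg A\<^esub> \<beta>" using i arr_D_alg_mono[OF subset_refl that(2)[OF R]] by blast
  qed
  have u: "\<exists>u \<in> filt B. \<forall>a \<in> carrier A. \<forall>a' \<in> carrier A. a \<sqsubseteq>\<^bsub>A\<^esub> a' \<longrightarrow> u \<in> ?G a \<leadsto>\<^bsub>D_alg B\<^esub> ?G a'"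
  proof -
    let ?R = "{(principal A a, principal A a') | a a'. a \<in> carrier A \<and> a' \<in> carrier A \<and> a \<sqsubseteq>\<^bsub>A\<^esub> a'}"
    have "\<exists>e \<in> filt B. \<forall>(\<alpha>, \<beta>) \<in> ?R. e \<in> g \<alpha> \<leadsto>\<^bsub>D_alg B\<^esub> g \<beta>"
    proof (rule le)
      show "?R \<subseteq> downsets A \<times> downsets A" by (auto intro: pD)
      fix \<alpha> \<beta> assume "(\<alpha>, \<beta>) \<in> ?R"
      then obtain a a' where a: "a \<in> carrier A" "a' \<in> carrier A" "a \<sqsubseteq>\<^bsub>A\<^esub> a'"
        and \<alpha>: "\<alpha> = principal A a" and \<beta>: "\<beta> = principal A a'" by blast
      have "a \<in> principal A a'" using a by (simp add: kleisli_id_def)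
      then show "\<alpha> \<subseteq> \<beta>" unfolding \<alpha> \<beta> by (rule A.principal_subset_iff[OF pD[OF a(2)] a(1), THEN iffD2])
    qed
    then obtain u where u: "u \<in> filt B" "\<forall>(\<alpha>, \<beta>) \<in> ?R. u \<in> g \<alpha> \<leadsto>\<^bsub>D_alg B\<^esub> g \<beta>" by blast
    then show ?thesis unfolding along_principal_def by (intro bexI[of _ u]) auto
  qed
  have t: "\<exists>t \<in> filt B. \<forall>a \<in> carrier A. \<forall>a' \<in> carrier A. \<forall>c. a \<bullet>\<^bsub>A\<^esub> a' = Some c \<longrightarrow>
         t \<in> ?G a \<leadsto>\<^bsub>D_alg B\<^esub> ?G a' \<leadsto>\<^bsub>D_alg B\<^esub> ?G c"
  proof -
    let ?R = "{(principal A a, principal A a' \<leadsto>\<^bsub>D_alg A\<^esub> principal A c) | a a' c.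
        a \<in> carrier A \<and> a' \<in> carrier A \<and> c \<in> carrier A \<and> a \<bullet>\<^bsub>A\<^esub> a' = Some c}"
    have "\<exists>e \<in> filt B. \<forall>(\<alpha>, \<beta>) \<in> ?R. e \<in> g \<alpha> \<leadsto>\<^bsub>D_alg B\<^esub> g \<beta>"
    proof (rule le)
      show "?R \<subseteq> downsets A \<times> downsets A" by (auto intro!: pD A.arr_downset)
      fix \<alpha> \<beta> assume "(\<alpha>, \<beta>) \<in> ?R"
      then obtain a a' c where c: "a \<in> carrier A" "a' \<in> carrier A" "c \<in> carrier A" "a \<bullet>\<^bsub>A\<^esub> a' = Some c"
        and \<alpha>: "\<alpha> = principal A a" and \<beta>: "\<beta> = principal A a' \<leadsto>\<^bsub>D_alg A\<^esub> principal A c" by blast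
      have "a \<bullet>\<^bsub>A\<^esub> a' \<in> Some ` principal A c" using c(4) A.principal_self[OF c(3)] by simp
      then have "x \<bullet>\<^bsub>A\<^esub> y \<in> Some ` principal A c" if "x \<in> principal A a" "y \<in> principal A a'" for x y
        by (rule A.app_downset[OF that c(1,2) _ pD[OF c(3)]])
      then show "\<alpha> \<subseteq> \<beta>" unfolding \<alpha> \<beta> by (auto simp: mem_arr_D_alg kleisli_id_def)
    qed
    then obtain q where "q \<in> filt B" and q: "\<forall>(\<alpha>, \<beta>) \<in> ?R. q \<in> g \<alpha> \<leadsto>\<^bsub>D_alg B\<^esub> g \<beta>" by blast
    obtain t where "t \<in> filt B" and t: "\<forall>\<alpha> \<in> downsets B. \<forall>\<beta> \<in> downsets B. \<forall>\<gamma> \<in> downsets B.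
        q \<in> \<alpha> \<leadsto>\<^bsub>D_alg B\<^esub> \<beta> \<longrightarrow> r \<in> \<beta> \<leadsto>\<^bsub>D_alg B\<^esub> \<gamma> \<longrightarrow> t \<in> \<alpha> \<leadsto>\<^bsub>D_alg B\<^esub> \<gamma>"
      using B.ex_composition_realizer[OF \<open>q \<in> filt B\<close> \<open>r \<in> filt B\<close>] by blast
    have "t \<in> ?G a \<leadsto>\<^bsub>D_alg B\<^esub> ?G a' \<leadsto>\<^bsub>D_alg B\<^esub> ?G c"
      if a: "a \<in> carrier A" "a' \<in> carrier A" "a \<bullet>\<^bsub>A\<^esub> a' = Some c" for a a' c
    proof -
      have c: "c \<in> carrier A" by (rule A.app_closed[OF a])
      note D = funcset_mem[OF gD pD[OF a(1)]] funcset_mem[OF gD A.arr_downset[OF pD[OF a(2)] pD[OF c]]]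
        B.arr_downset[OF funcset_mem[OF gD pD[OF a(2)]] funcset_mem[OF gD pD[OF c]]]
      have "q \<in> g (principal A a) \<leadsto>\<^bsub>D_alg B\<^esub> g (principal A a' \<leadsto>\<^bsub>D_alg A\<^esub> principal A c)"
        using q a c by blast
      then show ?thesis unfolding along_principal_def
        by (rule t[rule_format, OF D]) (rule r[OF pD[OF a(2)] pD[OF c]])
    qed
    then show ?thesis using \<open>t \<in> filt B\<close> by blast
  qed
  have "?G a \<in> D_filter B" if "a \<in> filt A" for a
    using filt A.principal_D_filter[OF that] by (simp add: along_principal_def)
  then show ?thesis unfolding OPCA_D_iff using along_principal_downsets[OF gD] t u by blast
qed

lemma along_principal_mono:
  assumes g: "g \<in> downsets A \<rightarrow> downsets B" "g' \<in> downsets A \<rightarrow> downsets B"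
    and "ArrAlg_le (D_alg A) (D_alg B) g g'"
  shows "OPCA_D_le A B (along_principal A g) (along_principal A g')"
  using assms(3) A.principal_downset
  unfolding ArrAlg_le_iff[OF g] OPCA_D_le_iff[OF along_principal_downsets[OF g(1)] along_principal_downsets[OF g(2)]]
  by (auto simp: along_principal_def)

text \<open>
  The composite sends \<open>a\<close> to \<open>\<Union>b \<sqsubseteq> a. f b\<close>. This contains \<open>f a\<close>, and the monotonicity realizer of \<open>f\<close>
  maps it back into \<open>f a\<close>.
\<close>

lemma along_principal_D_tilde:
  assumes f: "f \<in> OPCA_D A B"
  shows "OPCA_D_le A B (along_principal A (D_tilde f)) f"
    and "OPCA_D_le A B f (along_principal A (D_tilde f))"
proof -
  have fD: "f \<in> carrier A \<rightarrow> downsets B" using f unfolding OPCA_D_iff by blast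
  note GD = along_principal_downsets[OF D_tilde_downsets[OF fD]]
  obtain u where u: "u \<in> filt B"
    "\<And>a a'. \<lbrakk>a \<in> carrier A; a' \<in> carrier A; a \<sqsubseteq>\<^bsub>A\<^esub> a'\<rbrakk> \<Longrightarrow> u \<in> f a \<leadsto>\<^bsub>D_alg B\<^esub> f a'"
    using f unfolding OPCA_D_iff by blast
  have "u \<in> along_principal A (D_tilde f) a \<leadsto>\<^bsub>D_alg B\<^esub> f a" if a: "a \<in> carrier A" for a
  proof -
    have "u \<bullet>\<^bsub>B\<^esub> x \<in> Some ` f a" if "x \<in> along_principal A (D_tilde f) a" for x
    proof -
      obtain b where b: "b \<in> carrier A" "b \<sqsubseteq>\<^bsub>A\<^esub> a" "x \<in> f b"
        using \<open>x \<in> along_principal A (D_tilde f) a\<close>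
        by (auto simp: along_principal_def D_tilde_def kleisli_id_def)
      then show ?thesis using u(2)[OF b(1) a b(2)] by (simp add: mem_arr_D_alg)
    qed
    then show ?thesis using u(1) B.filt_subset by (auto simp: mem_arr_D_alg)
  qed
  then show "OPCA_D_le A B (along_principal A (D_tilde f)) f"
    unfolding OPCA_D_le_iff[OF GD fD] using u(1) by blast
  obtain i where i: "i \<in> filt B" "\<And>\<beta>. \<beta> \<in> downsets B \<Longrightarrow> i \<in> \<beta> \<leadsto>\<^bsub>D_alg B\<^esub> \<beta>"
    using B.ex_identity_realizer by blast
  have "i \<in> f a \<leadsto>\<^bsub>D_alg B\<^esub> along_principal A (D_tilde f) a" if a: "a \<in> carrier A" for a
  proof -
    have "f a \<subseteq> along_principal A (D_tilde f) a"
      using A.principal_self[OF a] by (auto simp: along_principal_def D_tilde_def)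
    then show ?thesis using i(2)[OF funcset_mem[OF fD a]] arr_D_alg_mono[OF subset_refl] by blast
  qed
  then show "OPCA_D_le A B f (along_principal A (D_tilde f))"
    unfolding OPCA_D_le_iff[OF fD GD] using i(1) by blast
qed

text \<open>
  Regularity at the family \<open>principal A ` \<alpha>\<close>, whose union is \<open>\<alpha>\<close>.
\<close>

lemma D_tilde_along_principal:
  assumes g: "g \<in> ArrAlg_reg (D_alg A) (D_alg B)"
  shows "ArrAlg_le (D_alg A) (D_alg B) (D_tilde (along_principal A g)) g"
    and "ArrAlg_le (D_alg A) (D_alg B) g (D_tilde (along_principal A g))"
proof -
  have gD: "g \<in> downsets A \<rightarrow> downsets B" using g unfolding ArrAlg_reg_def ArrAlg_D_alg_iff by blast
  note GD = D_tilde_downsets[OF along_principal_downsets[OF gD]]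
  have S: "principal A ` \<alpha> \<subseteq> downsets A" "\<Union> (principal A ` \<alpha>) = \<alpha>"
      "D_tilde (along_principal A g) \<alpha> = \<Union> (g ` principal A ` \<alpha>)" if "\<alpha> \<in> downsets A" for \<alpha>
    using A.Union_principal[OF that] A.principal_downset downsets_subset[OF that]
    by (auto simp: D_tilde_def along_principal_def)
  obtain p where "p \<in> filt B" and p: "\<forall>\<S> \<subseteq> downsets A. p \<in> \<Union> (g ` \<S>) \<leadsto>\<^bsub>D_alg B\<^esub> g (\<Union>\<S>)"
    using regular_Union_realizers(2)[OF g] by blast
  then show "ArrAlg_le (D_alg A) (D_alg B) (D_tilde (along_principal A g)) g"
    unfolding ArrAlg_le_iff[OF GD gD]
  proof (intro bexI[of _ p] ballI)
    fix \<alpha> assume "\<alpha> \<in> downsets A"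
    note S = S[OF this]
    show "p \<in> D_tilde (along_principal A g) \<alpha> \<leadsto>\<^bsub>D_alg B\<^esub> g \<alpha>"
      using p[rule_format, OF S(1)] unfolding S(2,3) .
  qed
  obtain q where "q \<in> filt B" and q: "\<forall>\<S> \<subseteq> downsets A. q \<in> g (\<Union>\<S>) \<leadsto>\<^bsub>D_alg B\<^esub> \<Union> (g ` \<S>)"
    using regular_Union_realizers(1)[OF g] by blast
  then show "ArrAlg_le (D_alg A) (D_alg B) g (D_tilde (along_principal A g))"
    unfolding ArrAlg_le_iff[OF gD GD]
  proof (intro bexI[of _ q] ballI)
    fix \<alpha> assume "\<alpha> \<in> downsets A"
    note S = S[OF this]
    show "q \<in> g \<alpha> \<leadsto>\<^bsub>D_alg B\<^esub> D_tilde (along_principal A g) \<alpha>"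
      using q[rule_format, OF S(1)] unfolding S(2,3) .
  qed
qed

lemma preorder_equivalence_D_tilde:
  "preorder_equivalence (OPCA_D A B) (OPCA_D_le A B)
     (ArrAlg_reg (D_alg A) (D_alg B)) (ArrAlg_le (D_alg A) (D_alg B)) D_tilde"
proof -
  have fD: "f \<in> carrier A \<rightarrow> downsets B" if "f \<in> OPCA_D A B" for f
    using that unfolding OPCA_D_iff by blast
  have gA: "g \<in> ArrAlg (D_alg A) (D_alg B)" if "g \<in> ArrAlg_reg (D_alg A) (D_alg B)" for g
    using that unfolding ArrAlg_reg_def by blast
  have gD: "g \<in> downsets A \<rightarrow> downsets B" if "g \<in> ArrAlg_reg (D_alg A) (D_alg B)" for g
    using gA[OF that] unfolding ArrAlg_D_alg_iff by blast
  show ?thesis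
    unfolding preorder_equivalence_def
  proof (intro conjI bexI[of _ "along_principal A"] ballI)
    show "D_tilde \<in> OPCA_D A B \<rightarrow> ArrAlg_reg (D_alg A) (D_alg B)"
      by (rule Pi_I) (rule D_tilde_ArrAlg_reg)
    show "monotone_on (OPCA_D A B) (OPCA_D_le A B) (ArrAlg_le (D_alg A) (D_alg B)) D_tilde"
      by (rule monotone_onI) (rule D_tilde_mono[OF fD fD])
    show "along_principal A \<in> ArrAlg_reg (D_alg A) (D_alg B) \<rightarrow> OPCA_D A B"
      by (rule Pi_I) (rule along_principal_OPCA_D[OF gA])
    show "monotone_on (ArrAlg_reg (D_alg A) (D_alg B)) (ArrAlg_le (D_alg A) (D_alg B)) (OPCA_D_le A B)
        (along_principal A)"
      by (rule monotone_onI) (rule along_principal_mono[OF gD gD])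
  qed (fact along_principal_D_tilde D_tilde_along_principal)+
qed

end

lemma D_tilde_kleisli_id:
  assumes "pca A" "\<alpha> \<in> downsets A"
  shows "D_tilde (kleisli_id A) \<alpha> = \<alpha>"
  using pca.Union_principal[OF assms] by (simp add: D_tilde_def)

lemma D_tilde_kleisli_comp: "D_tilde (kleisli_comp g f) \<alpha> = (D_tilde g \<circ> D_tilde f) \<alpha>"
  by (auto simp: D_tilde_def kleisli_comp_def)

theorem proposition6p14:
  fixes A :: "('a, 'l) pca_structure_scheme"
    and B :: "('b, 'm) pca_structure_scheme"
    and C :: "('c, 'n) pca_structure_scheme"
  assumes "pca A" and "pca B" and "pca C"
  shows "arrow_algebra (D_alg A)
    \<and> (\<forall>f \<in> OPCA_D A B. D_tilde f \<in> ArrAlg_reg (D_alg A) (D_alg B)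
          \<and> regular_over TYPE('i) TYPE('j) (D_alg A) (D_alg B) (D_tilde f))
    \<and> (\<forall>f \<in> OPCA_D A B. \<forall>f' \<in> OPCA_D A B. OPCA_D_le A B f f'
          \<longrightarrow> ArrAlg_le (D_alg A) (D_alg B) (D_tilde f) (D_tilde f'))
    \<and> (\<forall>\<alpha> \<in> carrier (D_alg A). D_tilde (kleisli_id A) \<alpha> = \<alpha>)
    \<and> (\<forall>f \<in> OPCA_D A B. \<forall>g \<in> OPCA_D B C. \<forall>\<alpha> \<in> carrier (D_alg A).
          D_tilde (kleisli_comp g f) \<alpha> = (D_tilde g \<circ> D_tilde f) \<alpha>)
    \<and> preorder_equivalence (OPCA_D A B) (OPCA_D_le A B)
          (ArrAlg_reg (D_alg A) (D_alg B)) (ArrAlg_le (D_alg A) (D_alg B)) D_tilde"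
proof -
  interpret A: pca A by fact
  interpret pca_pair A B by (rule pca_pair.intro) fact+
  have fD: "f \<in> carrier A \<rightarrow> downsets B" if "f \<in> OPCA_D A B" for f
    using that unfolding OPCA_D_iff by blast
  show ?thesis
    using A.arrow_algebra_D_alg D_tilde_ArrAlg_reg D_tilde_regular_over D_tilde_mono[OF fD fD]
      D_tilde_kleisli_id[OF assms(1)] D_tilde_kleisli_comp preorder_equivalence_D_tilde
    by (intro conjI ballI impI) simp_all
qed

end
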